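(* Let $(\mathbf{X},d)$ be a complete length space, let $\Omega\subsetneq\mathbf{X}$ be a bounded domain, and let $(\overline{\Omega},d,\mu)$ be a complete bounded metric measure space with $\mu$ a doubling measure. Let $f$ be a positive Borel measurable function on $\overline\Omega$. Assume that $\overline{\Omega}$ satisfies an $\infty$-Poincaré inequality and that $f\in L^\infty(\overline{\Omega})$. Then there exists a constant $C\ge1$ such that for any distinct $x,y\in\overline{\Omega}$ there exists a curve $\gamma\in\Gamma(x,y;C)\cap\Gamma_f(x,y)$ in $\overline{\Omega}$. In particular, $\Gamma_f(x,y)\neq\emptyset$ for all $x,y\in\overline\Omega$, and $\sup\{L_f(x,y):x,y\in\overline\Omega,\ d(x,y)\le r\}\to0$ as $r\to0$, with $$L_f(x,y)\le C\,\|f\|_{L^\infty(\overline\Omega)}\,d(x,y)\quad\text{for all }x,y\in\overline{\Omega}.$$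
   Context: Doubling: $\mu$ is a locally finite Borel measure, balls have positive finite measure, and there is $C_d\ge1$ with $\mu(B_{2r}(x))\le C_d\,\mu(B_r(x))$ for all $x$ and $r>0$. A Borel function $\rho$ with values in $[0,\infty]$ is an upper gradient of $w$ if $|w(\gamma(a))-w(\gamma(b))|\le\int_\gamma\rho\,ds$ for every rectifiable curve $\gamma:[a,b]\to\overline\Omega$. $(\overline{\Omega},d,\mu)$ supports an $\infty$-Poincaré inequality if there are constants $C'>0$, $\lambda\ge1$ such that for every measurable $w$, every upper gradient $\rho$ of $w$ and every ball $B$, $\frac{1}{\mu(B)}\int_B|w-w_B|\,d\mu\le C'\,\mathrm{diam}(B)\,\|\rho\|_{L^\infty(\lambda B)}$, where $w_B$ is the mean of $w$ over $B$ and $\lambda B$ is the ball with the same center and $\lambda$ times the radius. $\Gamma(x,y;C)$ denotes the collection of $C$-quasiconvex curves in $\overline\Omega$ connecting $x$ and $y$, i.e. curves of length at most $C\,d(x,y)$. $\Gamma_f(x,y)$ is the set of rectifiable curves $\gamma:[0,\ell]\to\overline{\Omega}$, parametrized by arc length, with $\gamma(0)=x$, $\gamma(\ell)=y$ and $\int_\gamma f\,ds<\infty$ (the constant curve is allowed when $x=y$), and $L_f(x,y):=\inf\{\int_\gamma f\,ds:\gamma\in\Gamma_f(x,y)\}$. Here $f$ is a fixed everywhere-defined function, not an a.e.-equivalence class. *)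

theory Defs
  imports "HOL-Analysis.Analysis" "HOL-Probability.Essential_Supremum"
begin

(* A curve is a triple (a, b, \<gamma>): the compact parameter interval [a, b] together with a map
   that is only looked at on [a, b].  Lengths and line integrals are extended nonnegative reals. *)
type_synonym 'a curve = "real \<times> real \<times> (real \<Rightarrow> 'a)"

definition is_curve_in :: "'a::metric_space set \<Rightarrow> 'a curve \<Rightarrow> bool" where
  "is_curve_in S = (\<lambda>(a, b, \<gamma>). a \<le> b \<and> continuous_on {a..b} \<gamma> \<and> \<gamma> ` {a..b} \<subseteq> S)"

definition curve_length :: "'a::metric_space curve \<Rightarrow> ennreal" where
  "curve_length = (\<lambda>(a, b, \<gamma>).
     SUP (n, t) \<in> {(n :: nat, t :: nat \<Rightarrow> real). mono_on {..n} t \<and> t ` {..n} \<subseteq> {a..b}}.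
       \<Sum>i<n. ennreal (dist (\<gamma> (t i)) (\<gamma> (t (Suc i)))))"

definition rectifiable_in :: "'a::metric_space set \<Rightarrow> 'a curve \<Rightarrow> bool" where
  "rectifiable_in S c \<longleftrightarrow> is_curve_in S c \<and> curve_length c < \<infinity>"

(* The arc-length reparametrization of a rectifiable curve, defined on [0, length].  The choice of
   the parameter t is immaterial, because \<gamma> is constant on the level sets of the length function. *)
definition arclength_reparam :: "'a::metric_space curve \<Rightarrow> real \<Rightarrow> 'a" where
  "arclength_reparam = (\<lambda>(a, b, \<gamma>) s.
     \<gamma> (SOME t. t \<in> {a..b} \<and> curve_length (a, t, \<gamma>) = ennreal s))"

definition line_integral :: "'a::metric_space curve \<Rightarrow> ('a \<Rightarrow> ennreal) \<Rightarrow> ennreal" where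
  "line_integral c \<rho> =
     (\<integral>\<^sup>+ s \<in> {0..enn2real (curve_length c)}. \<rho> (arclength_reparam c s) \<partial>lborel)"

definition joins :: "'a curve \<Rightarrow> 'a \<Rightarrow> 'a \<Rightarrow> bool" where
  "joins = (\<lambda>(a, b, \<gamma>) x y. \<gamma> a = x \<and> \<gamma> b = y)"

(* The infimum of the empty set is \<infinity>, so any two points are joined by a rectifiable curve. *)
definition length_space :: "'a::metric_space set \<Rightarrow> bool" where
  "length_space S \<longleftrightarrow> (\<forall>x\<in>S. \<forall>y\<in>S.
     ennreal (dist x y) = (INF c \<in> {c. is_curve_in S c \<and> joins c x y}. curve_length c))"

definition rel_ball :: "'a::metric_space set \<Rightarrow> 'a \<Rightarrow> real \<Rightarrow> 'a set" where
  "rel_ball S x r = ball x r \<inter> S"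

definition borel_measure_on :: "'a::metric_space set \<Rightarrow> 'a measure \<Rightarrow> bool" where
  "borel_measure_on S \<mu> \<longleftrightarrow> space \<mu> = S \<and> sets \<mu> = sets (restrict_space borel S)"

definition doubling_measure :: "'a::metric_space set \<Rightarrow> 'a measure \<Rightarrow> bool" where
  "doubling_measure S \<mu> \<longleftrightarrow>
     borel_measure_on S \<mu> \<and>
     (\<forall>x\<in>S. \<exists>r>0. emeasure \<mu> (rel_ball S x r) < \<infinity>) \<and>
     (\<forall>x\<in>S. \<forall>r>0. 0 < emeasure \<mu> (rel_ball S x r) \<and> emeasure \<mu> (rel_ball S x r) < \<infinity>) \<and>
     (\<exists>C\<^sub>d::real. C\<^sub>d \<ge> 1 \<and> (\<forall>x\<in>S. \<forall>r>0.
        emeasure \<mu> (rel_ball S x (2 * r)) \<le> ennreal C\<^sub>d * emeasure \<mu> (rel_ball S x r)))"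

definition upper_gradient :: "'a::metric_space set \<Rightarrow> ('a \<Rightarrow> ennreal) \<Rightarrow> ('a \<Rightarrow> real) \<Rightarrow> bool" where
  "upper_gradient S \<rho> w \<longleftrightarrow>
     \<rho> \<in> borel_measurable (restrict_space borel S) \<and>
     (\<forall>a b \<gamma>. rectifiable_in S (a, b, \<gamma>) \<longrightarrow>
        ennreal \<bar>w (\<gamma> a) - w (\<gamma> b)\<bar> \<le> line_integral (a, b, \<gamma>) \<rho>)"

definition mean_on :: "'a measure \<Rightarrow> 'a set \<Rightarrow> ('a \<Rightarrow> real) \<Rightarrow> real" where
  "mean_on M B w = (LINT z:B|M. w z) / measure M B"

(* "Measurable" functions w are those measurable with respect to the completion of \<mu>, whereas \<rho>
   is Borel.  If w is not integrable on B, then mean_on is 0 and the left-hand side is \<infinity>,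
   which is what the mean oscillation about any other real number would give as well. *)
definition infinity_poincare :: "'a::metric_space set \<Rightarrow> 'a measure \<Rightarrow> bool" where
  "infinity_poincare S \<mu> \<longleftrightarrow>
     (\<exists>C' > 0. \<exists>\<Lambda> \<ge> 1. \<forall>w \<rho> x r.
        w \<in> borel_measurable (completion \<mu>) \<and> upper_gradient S \<rho> w \<and> x \<in> S \<and> 0 < r \<longrightarrow>
        (\<integral>\<^sup>+ z \<in> rel_ball S x r. ennreal \<bar>w z - mean_on (completion \<mu>) (rel_ball S x r) w\<bar>
           \<partial>completion \<mu>) / emeasure \<mu> (rel_ball S x r)
        \<le> ennreal C' * ennreal (diameter (rel_ball S x r)) *
            esssup (restrict_space \<mu> (rel_ball S x (\<Lambda> * r))) \<rho>)"

definition Linf_norm :: "'a measure \<Rightarrow> ('a \<Rightarrow> real) \<Rightarrow> ennreal" where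
  "Linf_norm M f = esssup M (\<lambda>x. ennreal \<bar>f x\<bar>)"

definition in_Linf :: "'a measure \<Rightarrow> ('a \<Rightarrow> real) \<Rightarrow> bool" where
  "in_Linf M f \<longleftrightarrow> f \<in> borel_measurable M \<and> Linf_norm M f < \<infinity>"

definition quasiconvex_curves :: "'a::metric_space set \<Rightarrow> real \<Rightarrow> 'a \<Rightarrow> 'a \<Rightarrow> 'a curve set" where
  "quasiconvex_curves S C x y =
     {c. is_curve_in S c \<and> joins c x y \<and> curve_length c \<le> ennreal (C * dist x y)}"

definition arclength_parametrized :: "'a::metric_space curve \<Rightarrow> bool" where
  "arclength_parametrized = (\<lambda>(a, b, \<gamma>).
     a = 0 \<and> (\<forall>s t. 0 \<le> s \<and> s \<le> t \<and> t \<le> b \<longrightarrow> curve_length (s, t, \<gamma>) = ennreal (t - s)))"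

definition Gamma_f :: "'a::metric_space set \<Rightarrow> ('a \<Rightarrow> real) \<Rightarrow> 'a \<Rightarrow> 'a \<Rightarrow> 'a curve set" where
  "Gamma_f S f x y =
     {c. rectifiable_in S c \<and> arclength_parametrized c \<and> joins c x y \<and>
         line_integral c (\<lambda>z. ennreal (f z)) < \<infinity>}"

definition L_f :: "'a::metric_space set \<Rightarrow> ('a \<Rightarrow> real) \<Rightarrow> 'a \<Rightarrow> 'a \<Rightarrow> ennreal" where
  "L_f S f x y = (INF c \<in> Gamma_f S f x y. line_integral c (\<lambda>z. ennreal (f z)))"

end

theory Submission
  imports Defs
begin

text \<open>
  Write \<open>S\<close> for the closure of \<open>\<Omega>\<close>, \<open>M\<close> for the essential supremum of \<open>f\<close> and \<open>N\<close> for the set of points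
  where \<open>f\<close> exceeds \<open>M\<close>.  The set \<open>N\<close> is null, and the line integral of \<open>f\<close> along a curve that
  spends no time in \<open>N\<close> is at most \<open>M\<close> times its length.  So it is enough to join any two points
  \<open>x\<close> and \<open>y\<close> by a curve that spends no time in \<open>N\<close> and whose length is at most a constant times
  the distance of \<open>x\<close> and \<open>y\<close>.

  The Poincare inequality and doubling yield a constant \<open>L\<close> such that a continuous function with an
  upper gradient that is almost everywhere at most \<open>K\<close> is \<open>L * K\<close>-Lipschitz
  (\<open>infinity_poincare_imp_lipschitz\<close>).  Restricting to continuous functions avoids both the
  measurability of infima over families of curves and the choice of Lebesgue points.  The space
  \<open>S\<close> is compact by doubling.  Applied to the distance along chains of points with small steps,
  the Lipschitz bound and compactness show that any two points are joined by a curve of length at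
  most \<open>L\<close> times their distance (\<open>quasiconvex\<close>).

  For a bounded Borel weight \<open>h\<close>, let the weighted distance be the infimum of the integrals of \<open>h\<close> along
  1-Lipschitz curves.  By quasiconvexity it is continuous, and \<open>h\<close> is an upper gradient of it, so that
  it is at most \<open>L * K\<close> times the distance if \<open>h \<le> K\<close> almost everywhere.  In particular, a penalty on
  a null set, no matter how large, does not affect this bound.  Better, if such a weight is replaced by
  \<open>L * K\<close> on an open set, the weighted distance does not decrease (\<open>weighted_dist_le_replace\<close>), because
  along any curve the distance to the starting point grows neither faster than the weight
  nor faster than \<open>L * K\<close>.

  Now enclose \<open>N\<close> in a null intersection of a decreasing sequence of open sets \<open>U i\<close>, and start with
  the weight 1.  A curve that is nearly optimal for a weight with a large penalty on the intersection has
  nearly the same cost if the penalty is put on some \<open>U n\<close> instead.  By the replacement property,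
  the indicator of this \<open>U n\<close> can be added to the weight at an arbitrarily small loss, while
  arbitrary penalties on the intersection remain affordable (\<open>robust_weight_step\<close>).  Repeating this
  produces an increasing sequence of lower semicontinuous weights that tends to infinity on
  the intersection, and curves on which they have bounded integrals.  By compactness and
  Fatou's lemma a limit curve has bounded integrals for all these weights, so it spends no time in \<open>N\<close>
  (\<open>path_avoiding_null_set\<close>).  Its arc-length parametrization is the curve that was sought.
\<close>

section \<open>Length and arc-length parametrization of rectifiable curves\<close>

lemma polygon_le_curve_length:
  assumes "mono_on {..n} t" "t ` {..n} \<subseteq> {a..b}"
  shows "(\<Sum>i<n. ennreal (dist (\<gamma> (t i)) (\<gamma> (t (Suc i))))) \<le> curve_length (a, b, \<gamma>)"
  unfolding curve_length_def prod.case
  by (rule SUP_upper2[of "(n, t)"]) (use assms in auto)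

lemma curve_length_least:
  assumes "\<And>n t. mono_on {..n} t \<Longrightarrow> t ` {..n} \<subseteq> {a..b} \<Longrightarrow>
    (\<Sum>i<n. ennreal (dist (\<gamma> (t i)) (\<gamma> (t (Suc i))))) \<le> u"
  shows "curve_length (a, b, \<gamma>) \<le> u"
  unfolding curve_length_def prod.case
  by (rule SUP_least) (use assms in auto)

lemma less_curve_lengthE:
  assumes "u < curve_length (a, b, \<gamma>)"
  obtains n t where "mono_on {..n} t" "t ` {..n} \<subseteq> {a..b}"
    "u < (\<Sum>i<n. ennreal (dist (\<gamma> (t i)) (\<gamma> (t (Suc i)))))"
  using assms unfolding curve_length_def prod.case less_SUP_iff by auto

lemma dist_le_curve_length:
  assumes "a \<le> b"
  shows "ennreal (dist (\<gamma> a) (\<gamma> b)) \<le> curve_length (a, b, \<gamma>)"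
proof -
  have "(\<lambda>i::nat. if i = 0 then a else b) ` {..1} \<subseteq> {a..b}" using assms by auto
  from polygon_le_curve_length[OF _ this, of \<gamma>] show ?thesis
    using assms by (auto simp: mono_on_def)
qed

lemma curve_length_degenerate [simp]: "curve_length (a, a, \<gamma>) = 0"
proof -
  have "curve_length (a, a, \<gamma>) \<le> 0"
  proof (rule curve_length_least)
    fix n and t :: "nat \<Rightarrow> real" assume "t ` {..n} \<subseteq> {a..a}"
    then have "t i = a" if "i \<le> n" for i using that by auto
    then show "(\<Sum>i<n. ennreal (dist (\<gamma> (t i)) (\<gamma> (t (Suc i))))) \<le> 0" by simp
  qed
  then show ?thesis by simp
qed

lemma curve_length_lipschitz:
  assumes "1-lipschitz_on {a..b} \<gamma>" "a \<le> b"
  shows "curve_length (a, b, \<gamma>) \<le> ennreal (b - a)"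
proof (rule curve_length_least)
  fix n and t :: "nat \<Rightarrow> real" assume t: "mono_on {..n} t" "t ` {..n} \<subseteq> {a..b}"
  have mono: "t i \<le> t (Suc i)" if "i < n" for i
    using t(1) that by (auto simp: mono_on_def)
  have "(\<Sum>i<n. ennreal (dist (\<gamma> (t i)) (\<gamma> (t (Suc i))))) \<le> (\<Sum>i<n. ennreal (t (Suc i) - t i))"
  proof (intro sum_mono ennreal_leI)
    fix i assume "i \<in> {..<n}"
    then have "t i \<in> {a..b}" "t (Suc i) \<in> {a..b}" "t i \<le> t (Suc i)"
      using t(2) mono by (auto simp: image_subset_iff)
    then show "dist (\<gamma> (t i)) (\<gamma> (t (Suc i))) \<le> t (Suc i) - t i"
      using lipschitz_onD[OF assms(1), of "t i" "t (Suc i)"] by (auto simp: dist_real_def)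
  qed
  also have "\<dots> = ennreal (t n - t 0)"
    using mono by (subst sum_ennreal) (auto simp: sum_lessThan_telescope)
  also have "\<dots> \<le> ennreal (b - a)"
  proof -
    have "t n \<in> {a..b}" "t 0 \<in> {a..b}" using t(2) by auto
    then show ?thesis by (intro ennreal_leI) auto
  qed
  finally show "(\<Sum>i<n. ennreal (dist (\<gamma> (t i)) (\<gamma> (t (Suc i))))) \<le> ennreal (b - a)" .
qed

lemma curve_length_add_le:
  assumes "a \<le> b" "b \<le> c"
  shows "curve_length (a, b, \<gamma>) + curve_length (b, c, \<gamma>) \<le> curve_length (a, c, \<gamma>)"
proof -
  have concat: "(\<Sum>i<n. ennreal (dist (\<gamma> (s i)) (\<gamma> (s (Suc i))))) +
      (\<Sum>i<m. ennreal (dist (\<gamma> (t i)) (\<gamma> (t (Suc i))))) \<le> curve_length (a, c, \<gamma>)"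
    if s: "mono_on {..n} s" "s ` {..n} \<subseteq> {a..b}" and t: "mono_on {..m} t" "t ` {..m} \<subseteq> {b..c}"
    for n s m t
  proof -
    define r where "r i = (if i \<le> n then s i else t (i - Suc n))" for i
    have 1: "mono_on {..Suc n + m} r"
    proof (rule mono_onI)
      fix i j assume ij: "i \<in> {..Suc n + m}" "j \<in> {..Suc n + m}" "i \<le> j"
      consider "j \<le> n" | "i \<le> n" "j > n" | "i > n" by linarith
      then show "r i \<le> r j"
      proof cases
        case 2
        then have "s i \<in> {a..b}" "t (j - Suc n) \<in> {b..c}"
          using s(2) t(2) ij by (auto simp: image_subset_iff)
        then show ?thesis using 2 by (auto simp: r_def)
      next
        case 1
        then show ?thesis using ij mono_onD[OF s(1), of i j] by (auto simp: r_def)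
      next
        case 3
        then show ?thesis
          using ij mono_onD[OF t(1), of "i - Suc n" "j - Suc n"] by (auto simp: r_def)
      qed
    qed
    have 2: "r ` {..Suc n + m} \<subseteq> {a..c}"
    proof
      fix z assume "z \<in> r ` {..Suc n + m}"
      then obtain i where i: "i \<le> Suc n + m" "z = r i" by auto
      have "s i \<in> {a..b}" if "i \<le> n" using s(2) that by auto
      moreover have "t (i - Suc n) \<in> {b..c}" if "i > n"
        using t(2) that i by (auto simp: image_subset_iff)
      ultimately show "z \<in> {a..c}" using i assms by (auto simp: r_def)
    qed
    let ?d = "\<lambda>i. ennreal (dist (\<gamma> (r i)) (\<gamma> (r (Suc i))))"
    have "(\<Sum>i<n. ennreal (dist (\<gamma> (s i)) (\<gamma> (s (Suc i))))) +
      (\<Sum>i<m. ennreal (dist (\<gamma> (t i)) (\<gamma> (t (Suc i))))) =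
      (\<Sum>i<n. ?d i) + (\<Sum>i<m. ?d (Suc n + i))"
      by (intro arg_cong2[where f="(+)"] sum.cong) (auto simp: r_def)
    also have "\<dots> \<le> (\<Sum>i<Suc n. ?d i) + (\<Sum>i<m. ?d (Suc n + i))"
      by (intro add_right_mono) auto
    also have "\<dots> = (\<Sum>i<Suc n + m. ?d i)"
      by (induction m) (auto simp: add.assoc)
    also have "\<dots> \<le> curve_length (a, c, \<gamma>)"
      by (rule polygon_le_curve_length[OF 1 2])
    finally show ?thesis .
  qed
  show ?thesis
  proof (rule ccontr)
    assume "\<not> ?thesis"
    then have less: "curve_length (a, c, \<gamma>) < curve_length (a, b, \<gamma>) + curve_length (b, c, \<gamma>)"
      by simp
    let ?P = "\<lambda>a b. {(n :: nat, t :: nat \<Rightarrow> real). mono_on {..n} t \<and> t ` {..n} \<subseteq> {a..b}}"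
    have ne: "?P a b \<noteq> {}" if "a \<le> b" for a b
    proof -
      have "(0, \<lambda>_. a) \<in> ?P a b" using that by (auto simp: mono_on_def)
      then show ?thesis by blast
    qed
    have "curve_length (a, b, \<gamma>) + curve_length (b, c, \<gamma>) =
      (SUP p \<in> ?P a b. SUP q \<in> ?P b c.
        (\<Sum>i<fst p. ennreal (dist (\<gamma> (snd p i)) (\<gamma> (snd p (Suc i))))) +
        (\<Sum>i<fst q. ennreal (dist (\<gamma> (snd q i)) (\<gamma> (snd q (Suc i))))))"
      unfolding curve_length_def prod.case case_prod_beta
      by (subst ennreal_SUP_add_left[symmetric]) (use ne assms in \<open>auto simp: ennreal_SUP_add_right\<close>)
    also have "\<dots> \<le> curve_length (a, c, \<gamma>)"
      by (intro SUP_least) (use concat in auto)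
    finally show False using less by simp
  qed
qed

text \<open>A polygon on the whole interval splits into one on each part by truncating its parameters at
  \<^term>\<open>b\<close> from above and from below; the step across \<^term>\<open>b\<close> is where the triangle inequality enters.\<close>

lemma curve_length_le_add:
  assumes "a \<le> b" "b \<le> c"
  shows "curve_length (a, c, \<gamma>) \<le> curve_length (a, b, \<gamma>) + curve_length (b, c, \<gamma>)"
proof (rule curve_length_least)
  fix n and t :: "nat \<Rightarrow> real" assume t: "mono_on {..n} t" "t ` {..n} \<subseteq> {a..c}"
  have mono: "t i \<le> t (Suc i)" if "i < n" for i
    using t(1) that by (auto simp: mono_on_def)
  let ?l = "\<lambda>i. min b (t i)" and ?r = "\<lambda>i. max b (t i)"
  have "(\<Sum>i<n. ennreal (dist (\<gamma> (t i)) (\<gamma> (t (Suc i))))) \<le>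
     (\<Sum>i<n. ennreal (dist (\<gamma> (?l i)) (\<gamma> (?l (Suc i)))) + ennreal (dist (\<gamma> (?r i)) (\<gamma> (?r (Suc i)))))"
  proof (rule sum_mono)
    fix i assume "i \<in> {..<n}"
    then have "t i \<le> t (Suc i)" using mono by auto
    then have "dist (\<gamma> (t i)) (\<gamma> (t (Suc i))) \<le>
      dist (\<gamma> (?l i)) (\<gamma> (?l (Suc i))) + dist (\<gamma> (?r i)) (\<gamma> (?r (Suc i)))"
      by (auto simp: min_def max_def dist_triangle)
    then show "ennreal (dist (\<gamma> (t i)) (\<gamma> (t (Suc i)))) \<le>
      ennreal (dist (\<gamma> (?l i)) (\<gamma> (?l (Suc i)))) + ennreal (dist (\<gamma> (?r i)) (\<gamma> (?r (Suc i))))"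
      by (simp add: ennreal_plus[symmetric] ennreal_leI del: ennreal_plus)
  qed
  also have "\<dots> = (\<Sum>i<n. ennreal (dist (\<gamma> (?l i)) (\<gamma> (?l (Suc i))))) +
      (\<Sum>i<n. ennreal (dist (\<gamma> (?r i)) (\<gamma> (?r (Suc i)))))"
    by (rule sum.distrib)
  also have "\<dots> \<le> curve_length (a, b, \<gamma>) + curve_length (b, c, \<gamma>)"
    using t assms by (intro add_mono polygon_le_curve_length)
      (fastforce simp: mono_on_def image_subset_iff min_def max_def)+
  finally show "(\<Sum>i<n. ennreal (dist (\<gamma> (t i)) (\<gamma> (t (Suc i))))) \<le>
    curve_length (a, b, \<gamma>) + curve_length (b, c, \<gamma>)" .
qed

lemma curve_length_add:
  assumes "a \<le> b" "b \<le> c"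
  shows "curve_length (a, c, \<gamma>) = curve_length (a, b, \<gamma>) + curve_length (b, c, \<gamma>)"
  using curve_length_add_le[OF assms] curve_length_le_add[OF assms] by (rule antisym[rotated])

text \<open>Truncating the parameters of a nearly optimal polygon at a variable end point \<open>r\<close> gives polygons
  whose lengths depend continuously on \<open>r\<close>.\<close>

lemma curve_length_lsc_right:
  assumes "continuous_on {a..b} \<gamma>" "s \<in> {a..b}" "u < curve_length (a, s, \<gamma>)"
  shows "\<forall>\<^sub>F r in at s within {a..b}. u < curve_length (a, r, \<gamma>)"
proof -
  obtain n t where t: "mono_on {..n} t" "t ` {..n} \<subseteq> {a..s}"
    and u: "u < (\<Sum>i<n. ennreal (dist (\<gamma> (t i)) (\<gamma> (t (Suc i)))))"
    using less_curve_lengthE[OF assms(3)] .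
  let ?S = "\<lambda>r. \<Sum>i<n. ennreal (dist (\<gamma> (min r (t i))) (\<gamma> (min r (t (Suc i)))))"
  have S: "?S s = (\<Sum>i<n. ennreal (dist (\<gamma> (t i)) (\<gamma> (t (Suc i)))))"
    using t(2) by (intro sum.cong) (auto simp: image_subset_iff min_absorb2)
  have cont: "continuous_on {a..b} (\<lambda>r. \<gamma> (min r (t i)))" if "i \<le> n" for i
  proof (rule continuous_on_compose2[OF assms(1)])
    show "continuous_on {a..b} (\<lambda>r. min r (t i))" by (intro continuous_intros)
    show "(\<lambda>r. min r (t i)) ` {a..b} \<subseteq> {a..b}"
      using t(2) that assms(2) by (auto simp: image_subset_iff min_def)
  qed
  have "continuous_on {a..b} ?S"
    by (intro continuous_on_sum continuous_on_ennreal continuous_on_dist cont) auto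
  then have "(?S \<longlongrightarrow> ?S s) (at s within {a..b})"
    using assms(2) by (auto simp: continuous_on_def)
  then have "\<forall>\<^sub>F r in at s within {a..b}. u < ?S r"
    using u S by (intro order_tendstoD(1)) auto
  moreover have "?S r \<le> curve_length (a, r, \<gamma>)" if "r \<in> {a..b}" for r
    using t that by (intro polygon_le_curve_length) (fastforce simp: mono_on_def image_subset_iff min_def)+
  ultimately show ?thesis
    unfolding eventually_at_filter by (auto elim!: eventually_mono intro: less_le_trans)
qed

lemma curve_length_lsc_left:
  assumes "continuous_on {a..b} \<gamma>" "s \<in> {a..b}" "u < curve_length (s, b, \<gamma>)"
  shows "\<forall>\<^sub>F r in at s within {a..b}. u < curve_length (r, b, \<gamma>)"
proof -
  obtain n t where t: "mono_on {..n} t" "t ` {..n} \<subseteq> {s..b}"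
    and u: "u < (\<Sum>i<n. ennreal (dist (\<gamma> (t i)) (\<gamma> (t (Suc i)))))"
    using less_curve_lengthE[OF assms(3)] .
  let ?S = "\<lambda>r. \<Sum>i<n. ennreal (dist (\<gamma> (max r (t i))) (\<gamma> (max r (t (Suc i)))))"
  have S: "?S s = (\<Sum>i<n. ennreal (dist (\<gamma> (t i)) (\<gamma> (t (Suc i)))))"
    using t(2) by (intro sum.cong) (auto simp: image_subset_iff max_absorb2)
  have cont: "continuous_on {a..b} (\<lambda>r. \<gamma> (max r (t i)))" if "i \<le> n" for i
  proof (rule continuous_on_compose2[OF assms(1)])
    show "continuous_on {a..b} (\<lambda>r. max r (t i))" by (intro continuous_intros)
    show "(\<lambda>r. max r (t i)) ` {a..b} \<subseteq> {a..b}"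
      using t(2) that assms(2) by (auto simp: image_subset_iff max_def)
  qed
  have "continuous_on {a..b} ?S"
    by (intro continuous_on_sum continuous_on_ennreal continuous_on_dist cont) auto
  then have "(?S \<longlongrightarrow> ?S s) (at s within {a..b})"
    using assms(2) by (auto simp: continuous_on_def)
  then have "\<forall>\<^sub>F r in at s within {a..b}. u < ?S r"
    using u S by (intro order_tendstoD(1)) auto
  moreover have "?S r \<le> curve_length (r, b, \<gamma>)" if "r \<in> {a..b}" for r
    using t that by (intro polygon_le_curve_length) (fastforce simp: mono_on_def image_subset_iff max_def)+
  ultimately show ?thesis
    unfolding eventually_at_filter by (auto elim!: eventually_mono intro: less_le_trans)
qed

text \<open>The length of an initial piece is lower semicontinuous in its end point, because each
  polygonal sum is continuous in it; so is the length of the remaining piece.  As the two add up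
  to the finite total length, both are continuous.\<close>

lemma continuous_on_curve_length:
  assumes "continuous_on {a..b} \<gamma>" "curve_length (a, b, \<gamma>) < \<infinity>"
  shows "continuous_on {a..b} (\<lambda>t. enn2real (curve_length (a, t, \<gamma>)))"
proof -
  let ?f = "\<lambda>t. enn2real (curve_length (a, t, \<gamma>))" and ?g = "\<lambda>t. enn2real (curve_length (t, b, \<gamma>))"
  have add: "curve_length (a, b, \<gamma>) = curve_length (a, t, \<gamma>) + curve_length (t, b, \<gamma>)"
    if "t \<in> {a..b}" for t using that by (intro curve_length_add) auto
  have fin: "curve_length (a, t, \<gamma>) < \<infinity>" "curve_length (t, b, \<gamma>) < \<infinity>" if "t \<in> {a..b}" for t
    using assms(2) unfolding add[OF that] by (auto simp: less_top)
  have fg: "?f t + ?g t = enn2real (curve_length (a, b, \<gamma>))" if "t \<in> {a..b}" for t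
    using fin[OF that] unfolding add[OF that] by (subst enn2real_plus) (auto simp: infinity_ennreal_def)
  have less_enn2real: "u < enn2real x \<longleftrightarrow> ennreal u < x" if "x < \<infinity>" "u \<ge> 0" for u x
    using that by (cases x) (auto simp: ennreal_less_iff)
  have lsc_f: "\<forall>\<^sub>F r in at s within {a..b}. u < ?f r" if s: "s \<in> {a..b}" and u: "u < ?f s" for s u
  proof (cases "u < 0")
    case True
    then show ?thesis by (auto intro!: always_eventually order.strict_trans2[OF True])
  next
    case False
    then have "ennreal u < curve_length (a, s, \<gamma>)" using u fin(1)[OF s] less_enn2real by auto
    then have "\<forall>\<^sub>F r in at s within {a..b}. ennreal u < curve_length (a, r, \<gamma>)"
      by (rule curve_length_lsc_right[OF assms(1) s])
    then show ?thesis unfolding eventually_at_filter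
      by (rule eventually_mono) (use False fin(1) less_enn2real in auto)
  qed
  have lsc_g: "\<forall>\<^sub>F r in at s within {a..b}. u < ?g r" if s: "s \<in> {a..b}" and u: "u < ?g s" for s u
  proof (cases "u < 0")
    case True
    then show ?thesis by (auto intro!: always_eventually order.strict_trans2[OF True])
  next
    case False
    then have "ennreal u < curve_length (s, b, \<gamma>)" using u fin(2)[OF s] less_enn2real by auto
    then have "\<forall>\<^sub>F r in at s within {a..b}. ennreal u < curve_length (r, b, \<gamma>)"
      by (rule curve_length_lsc_left[OF assms(1) s])
    then show ?thesis unfolding eventually_at_filter
      by (rule eventually_mono) (use False fin(2) less_enn2real in auto)
  qed
  show ?thesis unfolding continuous_on_def
  proof
    fix s assume s: "s \<in> {a..b}"
    show "(?f \<longlongrightarrow> ?f s) (at s within {a..b})"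
    proof (rule order_tendstoI)
      fix u assume "u < ?f s" then show "\<forall>\<^sub>F r in at s within {a..b}. u < ?f r" by (rule lsc_f[OF s])
    next
      fix u assume "?f s < u"
      then have "enn2real (curve_length (a, b, \<gamma>)) - u < ?g s" using fg[OF s] by linarith
      from lsc_g[OF s this] show "\<forall>\<^sub>F r in at s within {a..b}. ?f r < u"
        unfolding eventually_at_filter
      proof (rule eventually_mono, intro impI)
        fix r assume r: "r \<noteq> s \<longrightarrow> r \<in> {a..b} \<longrightarrow> enn2real (curve_length (a, b, \<gamma>)) - u < ?g r"
          "r \<noteq> s" "r \<in> {a..b}"
        then show "?f r < u" using fg[of r] by auto
      qed
    qed
  qed
qed


locale rectifiable_curve =
  fixes a b :: real and \<gamma> :: "real \<Rightarrow> 'a::metric_space"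
  assumes le: "a \<le> b" and cont: "continuous_on {a..b} \<gamma>"
    and finite_length: "curve_length (a, b, \<gamma>) < \<infinity>"
begin

definition len :: "real \<Rightarrow> real" where "len t = enn2real (curve_length (a, t, \<gamma>))"

abbreviation \<sigma> :: "real \<Rightarrow> 'a" where "\<sigma> \<equiv> arclength_reparam (a, b, \<gamma>)"

lemma curve_length_finite: "a \<le> s \<Longrightarrow> s \<le> t \<Longrightarrow> t \<le> b \<Longrightarrow> curve_length (s, t, \<gamma>) < \<infinity>"
  using finite_length curve_length_add[of a s b \<gamma>] curve_length_add[of s t b \<gamma>]
  by (auto simp: less_top)

lemma ennreal_len: "t \<in> {a..b} \<Longrightarrow> ennreal (len t) = curve_length (a, t, \<gamma>)"
  using curve_length_finite[of a t] le by (auto simp: len_def)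

lemma curve_length_eq_len_diff:
  assumes "a \<le> s" "s \<le> t" "t \<le> b"
  shows "curve_length (s, t, \<gamma>) = ennreal (len t - len s)"
proof -
  have "curve_length (a, t, \<gamma>) = curve_length (a, s, \<gamma>) + curve_length (s, t, \<gamma>)"
    using assms by (intro curve_length_add) auto
  then have "len t = len s + enn2real (curve_length (s, t, \<gamma>))"
    using curve_length_finite[of a s] curve_length_finite[OF assms] assms
    by (simp add: len_def enn2real_plus)
  then show ?thesis using curve_length_finite[OF assms] by simp
qed

lemma len_mono: "a \<le> s \<Longrightarrow> s \<le> t \<Longrightarrow> t \<le> b \<Longrightarrow> len s \<le> len t"
  using curve_length_add[of a s t \<gamma>] curve_length_finite[of a t]
  by (auto simp: len_def intro!: enn2real_mono)

lemma dist_le_len_diff: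
  assumes "s \<in> {a..b}" "t \<in> {a..b}"
  shows "dist (\<gamma> s) (\<gamma> t) \<le> \<bar>len t - len s\<bar>"
proof -
  have "dist (\<gamma> s) (\<gamma> t) \<le> len t - len s" if "s \<le> t" "s \<in> {a..b}" "t \<in> {a..b}" for s t
    using dist_le_curve_length[of s t \<gamma>] that len_mono[of s t] curve_length_eq_len_diff[of s t]
    by auto
  from this[of s t] this[of t s] assms show ?thesis
    by (cases "s \<le> t") (auto simp: dist_commute)
qed

lemma len_start [simp]: "len a = 0"
  by (simp add: len_def)

lemma len_end: "len b = enn2real (curve_length (a, b, \<gamma>))"
  by (simp add: len_def)

lemma len_onto: "len ` {a..b} = {0..len b}"
proof
  show "len ` {a..b} \<subseteq> {0..len b}" using len_mono[of a] len_mono[of _ b] by auto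
  have c: "continuous_on {a..b} len"
    using continuous_on_curve_length[OF cont finite_length] unfolding len_def .
  show "{0..len b} \<subseteq> len ` {a..b}"
  proof
    fix s assume "s \<in> {0..len b}"
    then obtain t where "a \<le> t" "t \<le> b" "len t = s"
      using IVT'[of len a s b] le c by auto
    then show "s \<in> len ` {a..b}" by auto
  qed
qed

text \<open>The parameter selected by \<^const>\<open>arclength_reparam\<close> need not be \<^term>\<open>t\<close>, but the curve does not
  move between two parameters with the same arc length.\<close>

lemma reparam_len:
  assumes "t \<in> {a..b}"
  shows "\<sigma> (len t) = \<gamma> t"
proof -
  define u where "u = (SOME u. u \<in> {a..b} \<and> curve_length (a, u, \<gamma>) = ennreal (len t))"
  have "u \<in> {a..b} \<and> curve_length (a, u, \<gamma>) = ennreal (len t)"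
    unfolding u_def by (rule someI[of _ t]) (use assms ennreal_len in auto)
  then have u: "u \<in> {a..b}" "len u = len t" by (auto simp: len_def)
  have "dist (\<gamma> u) (\<gamma> t) \<le> 0" using dist_le_len_diff[OF u(1) assms] u(2) by simp
  then show ?thesis by (simp add: arclength_reparam_def u_def)
qed

lemma reparam_lipschitz: "1-lipschitz_on {0..len b} \<sigma>"
proof (rule lipschitz_onI)
  fix x y assume "x \<in> {0..len b}" "y \<in> {0..len b}"
  then obtain s t where "s \<in> {a..b}" "t \<in> {a..b}" "x = len s" "y = len t"
    unfolding len_onto[symmetric] by auto
  then show "dist (\<sigma> x) (\<sigma> y) \<le> 1 * dist x y"
    using dist_le_len_diff[of s t] by (simp add: reparam_len dist_real_def abs_minus_commute)
qed simp

lemma reparam_image: "\<sigma> ` {0..len b} = \<gamma> ` {a..b}"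
  unfolding len_onto[symmetric] image_image by (intro image_cong) (auto simp: reparam_len)

lemma reparam_start: "\<sigma> 0 = \<gamma> a" and reparam_end: "\<sigma> (len b) = \<gamma> b"
  using reparam_len[of a] reparam_len[of b] le by auto

text \<open>A polygon inscribed in \<^term>\<open>\<gamma>\<close> is also inscribed in its reparametrization, so the latter is
  not shorter; being 1-Lipschitz, it is not longer than its parameter interval.\<close>

lemma curve_length_reparam:
  assumes "0 \<le> x" "x \<le> y" "y \<le> len b"
  shows "curve_length (x, y, \<sigma>) = ennreal (y - x)"
proof (rule antisym)
  show "curve_length (x, y, \<sigma>) \<le> ennreal (y - x)"
    using assms by (intro curve_length_lipschitz lipschitz_on_subset[OF reparam_lipschitz]) auto
  have "x \<in> len ` {a..b}" "y \<in> len ` {a..b}" using assms by (auto simp: len_onto)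
  then obtain s t where st: "s \<in> {a..b}" "t \<in> {a..b}" "x = len s" "y = len t" by auto
  show "ennreal (y - x) \<le> curve_length (x, y, \<sigma>)"
  proof (cases "s \<le> t")
    case False
    then show ?thesis using len_mono[of t s] st by (simp add: ennreal_neg)
  next
    case True
    have "curve_length (s, t, \<gamma>) \<le> curve_length (x, y, \<sigma>)"
    proof (rule curve_length_least)
      fix n and p :: "nat \<Rightarrow> real" assume p: "mono_on {..n} p" "p ` {..n} \<subseteq> {s..t}"
      have p': "s \<le> p i" "p i \<le> t" "p i \<in> {a..b}" if "i \<le> n" for i
        using p(2) that st by (force simp: image_subset_iff)+
      have "(\<Sum>i<n. ennreal (dist (\<gamma> (p i)) (\<gamma> (p (Suc i))))) =
        (\<Sum>i<n. ennreal (dist (\<sigma> (len (p i))) (\<sigma> (len (p (Suc i))))))"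
        using p'(3) by (intro sum.cong) (auto simp: reparam_len)
      also have "\<dots> \<le> curve_length (x, y, \<sigma>)"
      proof (rule polygon_le_curve_length)
        show "mono_on {..n} (\<lambda>i. len (p i))"
          using p(1) p' by (intro mono_onI len_mono) (auto simp: mono_on_def)
        show "(\<lambda>i. len (p i)) ` {..n} \<subseteq> {x..y}"
          using p' st by (auto simp: image_subset_iff intro!: len_mono)
      qed
      finally show "(\<Sum>i<n. ennreal (dist (\<gamma> (p i)) (\<gamma> (p (Suc i))))) \<le> curve_length (x, y, \<sigma>)" .
    qed
    then show ?thesis using curve_length_eq_len_diff[of s t] st True by simp
  qed
qed

lemma arclength_parametrized_reparam: "arclength_parametrized (0, len b, \<sigma>)"
  by (auto simp: arclength_parametrized_def curve_length_reparam)

lemma line_integral_eq: "line_integral (a, b, \<gamma>) \<rho> = (\<integral>\<^sup>+ s \<in> {0..len b}. \<rho> (\<sigma> s) \<partial>lborel)"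
  by (simp add: line_integral_def len_end)

end

lemma line_integral_arclength_parametrized:
  assumes "arclength_parametrized (0, l, \<gamma>)" "0 \<le> l"
  shows "line_integral (0, l, \<gamma>) \<rho> = (\<integral>\<^sup>+ s \<in> {0..l}. \<rho> (\<gamma> s) \<partial>lborel)"
proof -
  have len: "curve_length (0, t, \<gamma>) = ennreal t" if "t \<in> {0..l}" for t
    using assms that by (auto simp: arclength_parametrized_def)
  have "arclength_reparam (0, l, \<gamma>) s = \<gamma> s" if s: "s \<in> {0..l}" for s
  proof -
    have "(SOME t. t \<in> {0..l} \<and> curve_length (0, t, \<gamma>) = ennreal s) = s"
      by (rule some_equality) (use s len in \<open>auto simp: ennreal_inj\<close>)
    then show ?thesis by (simp add: arclength_reparam_def)
  qed
  then show ?thesis using len[of l] assms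
    by (auto simp: line_integral_def intro!: nn_integral_cong split: split_indicator)
qed

section \<open>Limits of coarsely Lipschitz curves\<close>

text \<open>An Arzela--Ascoli theorem that allows jumps of vanishing size, so that it applies both to
  Lipschitz curves and to step functions along chains of points.  A subsequence converges at the
  rational parameters because a countable power of a compact set is sequentially compact; the
  coarse Lipschitz bound extends the convergence to all parameters.\<close>

lemma coarse_Arzela_Ascoli:
  fixes \<gamma> :: "nat \<Rightarrow> real \<Rightarrow> 'a::metric_space"
  assumes "compact S" "0 \<le> T"
    and in_S: "\<And>k t. t \<in> {0..T} \<Longrightarrow> \<gamma> k t \<in> S"
    and coarse: "\<And>k s t. s \<in> {0..T} \<Longrightarrow> t \<in> {0..T} \<Longrightarrow> dist (\<gamma> k s) (\<gamma> k t) \<le> \<bar>s - t\<bar> + e k"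
    and e: "e \<longlonglongrightarrow> 0"
  obtains r \<sigma> where "strict_mono (r :: nat \<Rightarrow> nat)"
    "\<And>t. t \<in> {0..T} \<Longrightarrow> (\<lambda>k. \<gamma> (r k) t) \<longlonglongrightarrow> \<sigma> t"
    "1-lipschitz_on {0..T} \<sigma>" "\<sigma> ` {0..T} \<subseteq> S"
proof -
  define c where "c q = max 0 (min T (of_rat q :: real))" for q
  have c: "c q \<in> {0..T}" for q using assms(2) by (auto simp: c_def)
  have "compactin (product_topology (\<lambda>i::rat. euclidean) UNIV) (PiE UNIV (\<lambda>_. S))"
    using assms(1) by (subst compactin_PiE) auto
  then have "compact (PiE UNIV (\<lambda>_::rat. S))"
    by (simp add: euclidean_product_topology)
  then have "seq_compact (PiE UNIV (\<lambda>_::rat. S))" by (rule compact_imp_seq_compact)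
  moreover have "\<forall>k. (\<lambda>q. \<gamma> k (c q)) \<in> PiE UNIV (\<lambda>_::rat. S)" using in_S c by auto
  ultimately obtain l r where r: "strict_mono (r :: nat \<Rightarrow> nat)"
    and l: "((\<lambda>k q. \<gamma> k (c q)) \<circ> r) \<longlonglongrightarrow> l"
    unfolding seq_compact_def by (elim allE[of _ "\<lambda>k q. \<gamma> k (c q)"]) auto
  have lq: "(\<lambda>k. \<gamma> (r k) (c q)) \<longlonglongrightarrow> l q" for q
    using continuous_on_tendsto_compose[OF continuous_on_product_coordinates[of q] l] by (simp add: o_def)
  have er: "(\<lambda>k. e (r k)) \<longlonglongrightarrow> 0"
    using LIMSEQ_subseq_LIMSEQ[OF e r] by (simp add: o_def)
  have "\<exists>l\<in>S. (\<lambda>k. \<gamma> (r k) t) \<longlonglongrightarrow> l" if t: "t \<in> {0..T}" for t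
  proof -
    have "Cauchy (\<lambda>k. \<gamma> (r k) t)"
    proof (rule metric_CauchyI)
      fix \<epsilon> :: real assume "0 < \<epsilon>"
      then obtain q where q: "t < of_rat q" "of_rat q < t + \<epsilon> / 8"
        using of_rat_dense[of t "t + \<epsilon> / 8"] by auto
      have cq: "\<bar>t - c q\<bar> < \<epsilon> / 8" using q t by (auto simp: c_def)
      obtain M1 where M1: "\<And>m n. m \<ge> M1 \<Longrightarrow> n \<ge> M1 \<Longrightarrow> dist (\<gamma> (r m) (c q)) (\<gamma> (r n) (c q)) < \<epsilon> / 2"
        using LIMSEQ_imp_Cauchy[OF lq[of q]] \<open>0 < \<epsilon>\<close> unfolding Cauchy_def by (metis half_gt_zero)
      obtain M2 where M2: "\<And>m. m \<ge> M2 \<Longrightarrow> \<bar>e (r m)\<bar> < \<epsilon> / 8"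
        using LIMSEQ_D[OF er, of "\<epsilon> / 8"] \<open>0 < \<epsilon>\<close> by auto
      show "\<exists>M. \<forall>m\<ge>M. \<forall>n\<ge>M. dist (\<gamma> (r m) t) (\<gamma> (r n) t) < \<epsilon>"
      proof (intro exI[of _ "max M1 M2"] allI impI)
        fix m n assume mn: "m \<ge> max M1 M2" "n \<ge> max M1 M2"
        have "dist (\<gamma> (r m) t) (\<gamma> (r n) t) \<le> dist (\<gamma> (r m) t) (\<gamma> (r m) (c q))
            + dist (\<gamma> (r m) (c q)) (\<gamma> (r n) (c q)) + dist (\<gamma> (r n) t) (\<gamma> (r n) (c q))"
          by (metis add.commute dist_commute dist_triangle_le dist_triangle2 add_left_mono)
        also have "\<dots> < \<epsilon>"
        proof -
          have "m \<ge> M1" "n \<ge> M1" "m \<ge> M2" "n \<ge> M2" using mn by auto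
          then show ?thesis
            using coarse[OF t c[of q], of "r m"] coarse[OF t c[of q], of "r n"] M1[of m n] M2[of m]
              M2[of n] cq by linarith
        qed
        finally show "dist (\<gamma> (r m) t) (\<gamma> (r n) t) < \<epsilon>" .
      qed
    qed
    moreover have "\<forall>k. \<gamma> (r k) t \<in> S" using in_S t by auto
    ultimately show ?thesis
      using compact_imp_complete[OF assms(1)] unfolding complete_def by auto
  qed
  then obtain \<sigma> where \<sigma>: "\<And>t. t \<in> {0..T} \<Longrightarrow> \<sigma> t \<in> S \<and> (\<lambda>k. \<gamma> (r k) t) \<longlonglongrightarrow> \<sigma> t"
    by metis
  show thesis
  proof (rule that[OF r])
    show "(\<lambda>k. \<gamma> (r k) t) \<longlonglongrightarrow> \<sigma> t" if "t \<in> {0..T}" for t using \<sigma> that by blast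
    show "\<sigma> ` {0..T} \<subseteq> S" using \<sigma> by auto
    show "1-lipschitz_on {0..T} \<sigma>"
    proof (rule lipschitz_onI)
      fix s t assume st: "s \<in> {0..T}" "t \<in> {0..T}"
      have "(\<lambda>k. dist (\<gamma> (r k) s) (\<gamma> (r k) t)) \<longlonglongrightarrow> dist (\<sigma> s) (\<sigma> t)"
        using \<sigma> st by (intro tendsto_dist) auto
      moreover have "(\<lambda>k. \<bar>s - t\<bar> + e (r k)) \<longlonglongrightarrow> \<bar>s - t\<bar> + 0"
        using er by (intro tendsto_intros)
      ultimately have "dist (\<sigma> s) (\<sigma> t) \<le> \<bar>s - t\<bar> + 0"
        by (rule LIMSEQ_le) (use coarse st in auto)
      then show "dist (\<sigma> s) (\<sigma> t) \<le> 1 * dist s t" by (simp add: dist_real_def)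
    qed simp
  qed
qed

lemma increment_le_if_locally_le:
  fixes \<phi> :: "real \<Rightarrow> real"
  assumes "0 < d" "0 \<le> T"
    and loc: "\<And>s t. 0 \<le> s \<Longrightarrow> s \<le> t \<Longrightarrow> t \<le> T \<Longrightarrow> t - s < d \<Longrightarrow> \<phi> t - \<phi> s \<le> K * (t - s)"
  shows "\<phi> T - \<phi> 0 \<le> K * T"
proof -
  obtain n :: nat where n: "T / d < real n" using reals_Archimedean2 by blast
  then have n0: "n > 0" using assms by (cases n) (auto simp: divide_less_0_iff)
  have nd: "T / real n < d" using n n0 assms by (simp add: field_simps)
  define p where "p i = real i * (T / real n)" for i
  have "\<phi> (p n) - \<phi> (p 0) = (\<Sum>i<n. \<phi> (p (Suc i)) - \<phi> (p i))"
    by (rule sum_lessThan_telescope[of "\<lambda>i. \<phi> (p i)", symmetric])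
  also have "\<dots> \<le> (\<Sum>i<n. K * (p (Suc i) - p i))"
  proof (intro sum_mono loc)
    fix i assume i: "i \<in> {..<n}"
    show "0 \<le> p i" "p i \<le> p (Suc i)"
      using assms unfolding p_def by (auto simp del: times_divide_eq_right intro!: mult_right_mono)
    have "p (Suc i) \<le> p n" unfolding p_def using assms i by (intro mult_right_mono) auto
    then show "p (Suc i) \<le> T" using n0 by (simp add: p_def)
    have "p (Suc i) - p i = T / real n" by (simp add: p_def algebra_simps add_divide_distrib)
    then show "p (Suc i) - p i < d" using nd by simp
  qed
  also have "\<dots> = K * (p n - p 0)"
    by (simp add: sum_distrib_left[symmetric] sum_lessThan_telescope)
  finally show ?thesis using n0 by (simp add: p_def)
qed

section \<open>Weighted path distances\<close>

text \<open>Speed at most 1, rather than unit speed, is preserved by limits.  For weights that are at least 1,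
  the parameter interval is still bounded by the cost of the curve.\<close>

definition lip_path :: "'a::metric_space set \<Rightarrow> 'a \<Rightarrow> 'a \<Rightarrow> real \<Rightarrow> (real \<Rightarrow> 'a) \<Rightarrow> bool" where
  "lip_path S x y T \<gamma> \<longleftrightarrow>
     0 \<le> T \<and> 1-lipschitz_on {0..T} \<gamma> \<and> \<gamma> ` {0..T} \<subseteq> S \<and> \<gamma> 0 = x \<and> \<gamma> T = y"

definition path_cost :: "('a \<Rightarrow> ennreal) \<Rightarrow> real \<Rightarrow> (real \<Rightarrow> 'a) \<Rightarrow> ennreal" where
  "path_cost h T \<gamma> = (\<integral>\<^sup>+ t \<in> {0..T}. h (\<gamma> t) \<partial>lborel)"

definition weighted_dist :: "'a::metric_space set \<Rightarrow> ('a \<Rightarrow> ennreal) \<Rightarrow> 'a \<Rightarrow> 'a \<Rightarrow> ennreal" where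
  "weighted_dist S h x y = (INF (T, \<gamma>) \<in> {(T, \<gamma>). lip_path S x y T \<gamma>}. path_cost h T \<gamma>)"

lemma lip_path_const: "x \<in> S \<Longrightarrow> lip_path S x x 0 (\<lambda>_. x)"
  by (auto simp: lip_path_def lipschitz_on_def)

lemma lip_path_reverse:
  assumes "lip_path S x y T \<gamma>"
  shows "lip_path S y x T (\<lambda>t. \<gamma> (T - t))"
proof -
  have "1-lipschitz_on {0..T} (\<lambda>t. \<gamma> (T - t))"
  proof (rule lipschitz_onI)
    fix s t assume "s \<in> {0..T}" "t \<in> {0..T}"
    then show "dist (\<gamma> (T - s)) (\<gamma> (T - t)) \<le> 1 * dist s t"
      using assms lipschitz_onD[of 1 "{0..T}" \<gamma> "T - s" "T - t"]
      by (auto simp: lip_path_def dist_real_def abs_minus_commute)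
  qed simp
  then show ?thesis using assms by (auto simp: lip_path_def image_subset_iff)
qed

lemma lip_path_sub:
  assumes "lip_path S x y T \<gamma>" "0 \<le> s" "s \<le> t" "t \<le> T"
  shows "lip_path S (\<gamma> s) (\<gamma> t) (t - s) (\<lambda>u. \<gamma> (s + u))"
proof -
  have "1-lipschitz_on {0..t - s} (\<lambda>u. \<gamma> (s + u))"
  proof (rule lipschitz_onI)
    fix u v assume "u \<in> {0..t - s}" "v \<in> {0..t - s}"
    then show "dist (\<gamma> (s + u)) (\<gamma> (s + v)) \<le> 1 * dist u v"
      using assms lipschitz_onD[of 1 "{0..T}" \<gamma> "s + u" "s + v"]
      by (auto simp: lip_path_def dist_real_def)
  qed simp
  then show ?thesis using assms by (auto simp: lip_path_def image_subset_iff)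
qed

lemma lip_path_concat:
  assumes "lip_path S x y T \<gamma>" "lip_path S y z U \<delta>"
  shows "lip_path S x z (T + U) (\<lambda>t. if t \<le> T then \<gamma> t else \<delta> (t - T))"
proof -
  have "1-lipschitz_on {0..T + U} (\<lambda>t. if t \<le> T then \<gamma> t else \<delta> (t - T))"
  proof (rule lipschitz_on_concat)
    show "1-lipschitz_on {T..T + U} (\<lambda>t. \<delta> (t - T))"
    proof (rule lipschitz_onI)
      fix u v assume "u \<in> {T..T + U}" "v \<in> {T..T + U}"
      then show "dist (\<delta> (u - T)) (\<delta> (v - T)) \<le> 1 * dist u v"
        using assms lipschitz_onD[of 1 "{0..U}" \<delta> "u - T" "v - T"]
        by (auto simp: lip_path_def dist_real_def)
    qed simp
  qed (use assms in \<open>auto simp: lip_path_def\<close>)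
  then show ?thesis using assms by (auto simp: lip_path_def image_subset_iff)
qed

lemma dist_le_lip_path: "lip_path S x y T \<gamma> \<Longrightarrow> dist x y \<le> T"
  using lipschitz_onD[of 1 "{0..T}" \<gamma> 0 T] by (auto simp: lip_path_def)

lemma path_cost_measurable:
  assumes "lip_path S x y T \<gamma>" and h: "h \<in> borel_measurable (restrict_space borel S)"
  shows "(\<lambda>t. h (\<gamma> t) * indicator {0..T} t :: ennreal) \<in> borel_measurable borel"
proof -
  have "continuous_on {0..T} \<gamma>" "\<gamma> ` {0..T} \<subseteq> S"
    using assms(1) lipschitz_on_continuous_on by (auto simp: lip_path_def)
  then have "\<gamma> \<in> measurable (restrict_space borel {0..T}) (restrict_space borel S)"
    by (intro measurable_restrict_space2 borel_measurable_continuous_on_restrict)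
       (auto simp: space_restrict_space)
  from measurable_compose[OF this h] show ?thesis
    by (subst (asm) borel_measurable_restrict_space_iff_ennreal) (auto simp: mult.commute)
qed

lemma path_cost_mono:
  assumes "lip_path S x y T \<gamma>" "\<And>z. z \<in> S \<Longrightarrow> h z \<le> k z"
  shows "path_cost h T \<gamma> \<le> path_cost k T \<gamma>"
  unfolding path_cost_def using assms
  by (intro nn_integral_mono) (auto simp: lip_path_def image_subset_iff split: split_indicator)

lemma path_cost_const:
  assumes "lip_path S x y T \<gamma>"
  shows "path_cost (\<lambda>_. c) T \<gamma> = c * ennreal T"
  using assms by (simp add: path_cost_def lip_path_def nn_integral_cmult)

lemma path_cost_reverse:
  assumes "lip_path S x y T \<gamma>" "h \<in> borel_measurable (restrict_space borel S)"
  shows "path_cost h T (\<lambda>t. \<gamma> (T - t)) = path_cost h T \<gamma>"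
proof -
  have "path_cost h T \<gamma> = (\<integral>\<^sup>+ t. h (\<gamma> (T + -1 * t)) * indicator {0..T} (T + -1 * t) \<partial>lborel)"
    unfolding path_cost_def using path_cost_measurable[OF assms]
    by (subst nn_integral_real_affine[where c="-1" and t=T]) auto
  also have "\<dots> = path_cost h T (\<lambda>t. \<gamma> (T - t))"
    unfolding path_cost_def by (intro nn_integral_cong) (auto split: split_indicator)
  finally show ?thesis by simp
qed

lemma path_cost_translate:
  assumes "lip_path S x y U \<delta>" "h \<in> borel_measurable (restrict_space borel S)"
  shows "(\<integral>\<^sup>+ t \<in> {T..T + U}. h (\<delta> (t - T)) \<partial>lborel) = path_cost h U \<delta>"
proof -
  have "path_cost h U \<delta> = (\<integral>\<^sup>+ t. h (\<delta> (-T + 1 * t)) * indicator {0..U} (-T + 1 * t) \<partial>lborel)"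
    unfolding path_cost_def using path_cost_measurable[OF assms]
    by (subst nn_integral_real_affine[where c="1" and t="-T"]) auto
  also have "\<dots> = (\<integral>\<^sup>+ t \<in> {T..T + U}. h (\<delta> (t - T)) \<partial>lborel)"
    by (intro nn_integral_cong) (auto split: split_indicator)
  finally show ?thesis by simp
qed

lemma path_cost_concat:
  assumes \<gamma>: "lip_path S x y T \<gamma>" and \<delta>: "lip_path S y z U \<delta>"
    and h: "h \<in> borel_measurable (restrict_space borel S)"
  shows "path_cost h (T + U) (\<lambda>t. if t \<le> T then \<gamma> t else \<delta> (t - T)) \<le> path_cost h T \<gamma> + path_cost h U \<delta>"
proof -
  have m: "(\<lambda>t. h (\<delta> (t - T)) * indicator {T..T + U} t) \<in> borel_measurable borel"
  proof -
    have "(\<lambda>t. h (\<delta> (t - T)) * indicator {0..U} (t - T)) \<in> borel_measurable borel"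
      by (rule measurable_compose[OF _ path_cost_measurable[OF \<delta> h]]) simp
    also have "(\<lambda>t. h (\<delta> (t - T)) * indicator {0..U} (t - T)) = (\<lambda>t. h (\<delta> (t - T)) * indicator {T..T + U} t)"
      by (auto split: split_indicator)
    finally show ?thesis .
  qed
  have "path_cost h (T + U) (\<lambda>t. if t \<le> T then \<gamma> t else \<delta> (t - T)) \<le>
     (\<integral>\<^sup>+ t. h (\<gamma> t) * indicator {0..T} t + h (\<delta> (t - T)) * indicator {T..T + U} t \<partial>lborel)"
    unfolding path_cost_def by (intro nn_integral_mono) (auto split: split_indicator)
  also have "\<dots> = path_cost h T \<gamma> + (\<integral>\<^sup>+ t \<in> {T..T + U}. h (\<delta> (t - T)) \<partial>lborel)"
    unfolding path_cost_def using path_cost_measurable[OF \<gamma> h] m by (intro nn_integral_add) auto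
  finally show ?thesis using path_cost_translate[OF \<delta> h] by simp
qed

lemma weighted_dist_le_path_cost: "lip_path S x y T \<gamma> \<Longrightarrow> weighted_dist S h x y \<le> path_cost h T \<gamma>"
  unfolding weighted_dist_def by (rule INF_lower2[of "(T, \<gamma>)"]) auto

lemma weighted_dist_lessE:
  assumes "weighted_dist S h x y < c"
  obtains T \<gamma> where "lip_path S x y T \<gamma>" "path_cost h T \<gamma> < c"
  using assms by (auto simp: weighted_dist_def INF_less_iff)

lemma weighted_dist_self [simp]:
  assumes "x \<in> S" shows "weighted_dist S h x x = 0"
proof -
  have "path_cost h 0 (\<lambda>_. x) = 0"
    unfolding path_cost_def by (subst nn_integral_0_iff_AE)
      (auto intro!: AE_I[of _ _ "{0}"] simp: indicator_def)
  then show ?thesis using weighted_dist_le_path_cost[OF lip_path_const[OF assms], of h] by simp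
qed

lemma weighted_dist_step:
  assumes "lip_path S y z T \<gamma>" "h \<in> borel_measurable (restrict_space borel S)"
  shows "weighted_dist S h x z \<le> weighted_dist S h x y + path_cost h T \<gamma>"
proof (rule ccontr)
  assume "\<not> ?thesis"
  then have less: "weighted_dist S h x y + path_cost h T \<gamma> < weighted_dist S h x z" by simp
  then have "path_cost h T \<gamma> < top" by (auto simp: less_top[symmetric])
  with less have "weighted_dist S h x y < weighted_dist S h x z - path_cost h T \<gamma>"
    by (subst less_diff_eq_ennreal) auto
  then obtain U \<delta> where \<delta>: "lip_path S x y U \<delta>"
    and "path_cost h U \<delta> < weighted_dist S h x z - path_cost h T \<gamma>"
    by (rule weighted_dist_lessE)
  with \<open>path_cost h T \<gamma> < top\<close> have "path_cost h U \<delta> + path_cost h T \<gamma> < weighted_dist S h x z"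
    by (subst (asm) less_diff_eq_ennreal) auto
  also have "weighted_dist S h x z \<le> path_cost h U \<delta> + path_cost h T \<gamma>"
    by (rule order_trans[OF weighted_dist_le_path_cost[OF lip_path_concat[OF \<delta> assms(1)]]
      path_cost_concat[OF \<delta> assms]])
  finally show False by simp
qed

text \<open>Both sides of the upper gradient inequality only depend on the arc-length parametrization, which is
  1-Lipschitz.\<close>

lemma upper_gradientI:
  assumes "\<rho> \<in> borel_measurable (restrict_space borel S)"
    and path: "\<And>x y T \<gamma>. lip_path S x y T \<gamma> \<Longrightarrow> ennreal \<bar>w x - w y\<bar> \<le> path_cost \<rho> T \<gamma>"
  shows "upper_gradient S \<rho> w"
  unfolding upper_gradient_def
proof (intro conjI assms(1) allI impI)
  fix a b and \<gamma> :: "real \<Rightarrow> 'a" assume "rectifiable_in S (a, b, \<gamma>)"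
  then interpret rectifiable_curve a b \<gamma>
    by unfold_locales (auto simp: rectifiable_in_def is_curve_in_def)
  have "lip_path S (\<gamma> a) (\<gamma> b) (len b) \<sigma>"
    using reparam_lipschitz reparam_image reparam_start reparam_end len_mono[of a b] le
      \<open>rectifiable_in S (a, b, \<gamma>)\<close>
    by (auto simp: lip_path_def rectifiable_in_def is_curve_in_def)
  from path[OF this] show "ennreal \<bar>w (\<gamma> a) - w (\<gamma> b)\<bar> \<le> line_integral (a, b, \<gamma>) \<rho>"
    by (simp add: line_integral_eq path_cost_def)
qed

section \<open>Chains of points\<close>

text \<open>Chains of points with steps shorter than \<open>\<epsilon>\<close> replace curves until curves of controlled length are
  known to exist: a connected set is connected by chains, and the distance along chains is
  continuous, because points closer than \<open>\<epsilon>\<close> are joined by a single step.\<close>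

inductive chain :: "'a::metric_space set \<Rightarrow> real \<Rightarrow> 'a \<Rightarrow> 'a \<Rightarrow> real \<Rightarrow> bool" for S \<epsilon> x where
  start: "x \<in> S \<Longrightarrow> chain S \<epsilon> x x 0"
| step: "chain S \<epsilon> x y l \<Longrightarrow> z \<in> S \<Longrightarrow> dist y z < \<epsilon> \<Longrightarrow> chain S \<epsilon> x z (l + dist y z)"

lemma chain_nonneg: "chain S \<epsilon> x y l \<Longrightarrow> 0 \<le> l"
  by (induction rule: chain.induct) auto

lemma chain_in: "chain S \<epsilon> x y l \<Longrightarrow> y \<in> S"
  by (induction rule: chain.induct) auto

lemma connected_imp_chain:
  assumes "connected S" "0 < \<epsilon>" "x \<in> S" "y \<in> S"
  shows "\<exists>l. chain S \<epsilon> x y l"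
proof -
  define A where "A = {y \<in> S. \<exists>l. chain S \<epsilon> x y l}"
  have near: "z \<in> A" if "y \<in> A" "z \<in> S" "dist y z < \<epsilon>" for y z
    using that by (auto simp: A_def intro: chain.step)
  have "openin (top_of_set S) A"
    unfolding openin_euclidean_subtopology_iff
  proof (intro conjI ballI)
    show "A \<subseteq> S" by (auto simp: A_def)
    show "\<exists>e>0. \<forall>z\<in>S. dist z y < e \<longrightarrow> z \<in> A" if "y \<in> A" for y
      using near[OF that] assms(2) by (metis dist_commute)
  qed
  moreover have "openin (top_of_set S) (S - A)"
    unfolding openin_euclidean_subtopology_iff
    using near assms(2) by (metis Diff_iff Diff_subset)
  then have "closedin (top_of_set S) A" by (auto simp: closedin_def A_def)
  moreover have "x \<in> A" using assms(3) by (auto simp: A_def intro: chain.start)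
  ultimately have "A = S" using assms(1) unfolding connected_clopen by blast
  then show ?thesis using assms(4) by (auto simp: A_def)
qed

text \<open>The step function that rests at each point of the chain for as long as the next step is long.\<close>

lemma chain_imp_coarse_path:
  assumes "chain S \<epsilon> x y l" "0 < \<epsilon>"
  shows "\<exists>\<gamma>. \<gamma> 0 = x \<and> \<gamma> l = y \<and> (\<forall>t. 0 \<le> t \<and> t \<le> l \<longrightarrow> \<gamma> t \<in> S) \<and>
    (\<forall>s t. 0 \<le> s \<and> s \<le> t \<and> t \<le> l \<longrightarrow> dist (\<gamma> s) (\<gamma> t) \<le> t - s + \<epsilon>)"
  using assms(1)
proof (induction rule: chain.induct)
  case start
  then show ?case using assms(2) by (intro exI[of _ "\<lambda>_. x"]) auto
next
  case (step y l z)
  then obtain \<gamma> where \<gamma>: "\<gamma> 0 = x" "\<gamma> l = y" "\<And>t. 0 \<le> t \<Longrightarrow> t \<le> l \<Longrightarrow> \<gamma> t \<in> S"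
    "\<And>s t. 0 \<le> s \<Longrightarrow> s \<le> t \<Longrightarrow> t \<le> l \<Longrightarrow> dist (\<gamma> s) (\<gamma> t) \<le> t - s + \<epsilon>" by blast
  let ?d = "dist y z"
  let ?\<delta> = "\<lambda>t. if t < l then \<gamma> t else if t < l + ?d then y else z"
  have l: "0 \<le> l" using chain_nonneg step.hyps(1) .
  have y: "y \<in> S" using chain_in step.hyps(1) .
  have "dist (?\<delta> s) (?\<delta> t) \<le> t - s + \<epsilon>" if st: "0 \<le> s" "s \<le> t" "t \<le> l + ?d" for s t
  proof -
    consider "t < l" | "s < l" "l \<le> t" "t < l + ?d" | "s < l" "t = l + ?d"
      | "l \<le> s" "s < l + ?d" "t = l + ?d" | "l \<le> s" "t < l + ?d" | "s = l + ?d" "t = l + ?d"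
      using st by linarith
    then show ?thesis
    proof cases
      case 2
      then show ?thesis using \<gamma>(4)[of s l] \<gamma>(2) st by auto
    next
      case 3
      then show ?thesis using \<gamma>(4)[of s l] \<gamma>(2) st dist_triangle[of "\<gamma> s" z y] by auto
    qed (use \<gamma> st assms(2) step.hyps in auto)
  qed
  moreover have "?\<delta> 0 = x" using l \<gamma> by (cases "y = z") (auto simp: not_less)
  moreover have "\<forall>t. 0 \<le> t \<and> t \<le> l + ?d \<longrightarrow> ?\<delta> t \<in> S" using \<gamma> y step.hyps by auto
  ultimately show ?case using l by (intro exI[of _ ?\<delta>]) auto
qed

definition chain_dist :: "'a::metric_space set \<Rightarrow> real \<Rightarrow> 'a \<Rightarrow> 'a \<Rightarrow> real" where
  "chain_dist S \<epsilon> x y = Inf {l. chain S \<epsilon> x y l}"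

lemma chain_dist_step:
  assumes "chain S \<epsilon> x y l" "z \<in> S" "dist y z < \<epsilon>"
  shows "chain_dist S \<epsilon> x z \<le> chain_dist S \<epsilon> x y + dist y z"
proof -
  have "chain_dist S \<epsilon> x z - dist y z \<le> k" if "chain S \<epsilon> x y k" for k
  proof -
    have "chain_dist S \<epsilon> x z \<le> k + dist y z"
      unfolding chain_dist_def using chain.step[OF that assms(2,3)]
      by (intro cInf_lower) (auto intro!: bdd_belowI[of _ 0] chain_nonneg)
    then show ?thesis by simp
  qed
  then have "chain_dist S \<epsilon> x z - dist y z \<le> chain_dist S \<epsilon> x y"
    unfolding chain_dist_def[of S \<epsilon> x y] using assms(1) by (intro cInf_greatest) auto
  then show ?thesis by simp
qed

section \<open>Spaces in which an upper gradient controls the Lipschitz constant\<close>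

text \<open>The constructions of curves below use the measure only through this Lipschitz estimate, which is
  also how the Poincare inequality enters them.\<close>

locale upper_gradient_lipschitz =
  fixes S :: "'a::metric_space set" and \<mu> :: "'a measure" and L :: real
  assumes compact: "compact S" and connected: "connected S" and space_eq: "space \<mu> = S"
    and L_ge_1: "1 \<le> L"
    and lipschitz: "\<And>w \<rho> K x y. continuous_on S w \<Longrightarrow> upper_gradient S \<rho> w \<Longrightarrow> 0 \<le> K \<Longrightarrow>
      AE z in \<mu>. \<rho> z \<le> ennreal K \<Longrightarrow> x \<in> S \<Longrightarrow> y \<in> S \<Longrightarrow> \<bar>w x - w y\<bar> \<le> L * K * dist x y"
begin

text \<open>Locally, the distance along chains changes at most as fast as the distance, so the constant 1 is an
  upper gradient of it.\<close>

lemma chain_dist_le: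
  assumes "0 < \<epsilon>" "x \<in> S" "y \<in> S"
  shows "chain_dist S \<epsilon> x y \<le> L * dist x y"
proof -
  let ?w = "chain_dist S \<epsilon> x"
  have w: "\<bar>?w y - ?w z\<bar> \<le> dist y z" if yz: "y \<in> S" "z \<in> S" "dist y z < \<epsilon>" for y z
  proof -
    obtain l k where "chain S \<epsilon> x y l" "chain S \<epsilon> x z k"
      using connected_imp_chain[OF connected assms(1,2)] yz by blast
    then have "?w z \<le> ?w y + dist y z" "?w y \<le> ?w z + dist z y"
      using chain_dist_step[of S \<epsilon> x y l z] chain_dist_step[of S \<epsilon> x z k y] yz
      by (auto simp: dist_commute)
    then show ?thesis by (auto simp: dist_commute)
  qed
  have "continuous_on S ?w"
    unfolding continuous_on_iff
  proof (intro ballI allI impI)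
    fix y e assume y: "y \<in> S" "0 < (e::real)"
    show "\<exists>d>0. \<forall>z\<in>S. dist z y < d \<longrightarrow> dist (?w z) (?w y) < e"
      using w[of _ y] y assms(1) by (intro exI[of _ "min e \<epsilon>"]) (auto simp: dist_real_def; fastforce)
  qed
  moreover have "upper_gradient S (\<lambda>_. 1) ?w"
  proof (rule upper_gradientI)
    fix y z T \<gamma> assume \<gamma>: "lip_path S y z T \<gamma>"
    have T: "0 \<le> T" using \<gamma> by (simp add: lip_path_def)
    have loc: "\<bar>?w (\<gamma> t) - ?w (\<gamma> s)\<bar> \<le> t - s" if "0 \<le> s" "s \<le> t" "t \<le> T" "t - s < \<epsilon>" for s t
    proof -
      have "dist (\<gamma> t) (\<gamma> s) \<le> t - s" "\<gamma> t \<in> S" "\<gamma> s \<in> S"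
        using \<gamma> that lipschitz_onD[of 1 "{0..T}" \<gamma> t s]
        by (auto simp: lip_path_def dist_real_def image_subset_iff)
      then show ?thesis using w[of "\<gamma> t" "\<gamma> s"] that by auto
    qed
    have "?w (\<gamma> T) - ?w (\<gamma> 0) \<le> 1 * T"
      using loc by (intro increment_le_if_locally_le[of \<epsilon> T "\<lambda>t. ?w (\<gamma> t)"] assms(1) T) force
    moreover have "- ?w (\<gamma> T) - - ?w (\<gamma> 0) \<le> 1 * T"
      using loc by (intro increment_le_if_locally_le[of \<epsilon> T "\<lambda>t. - ?w (\<gamma> t)"] assms(1) T) force
    ultimately have "\<bar>?w y - ?w z\<bar> \<le> T" using \<gamma> by (auto simp: lip_path_def)
    then show "ennreal \<bar>?w y - ?w z\<bar> \<le> path_cost (\<lambda>_. 1) T \<gamma>"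
      by (subst path_cost_const[OF \<gamma>]) (simp add: ennreal_leI)
  qed simp
  ultimately have "\<bar>?w y - ?w x\<bar> \<le> L * 1 * dist y x"
    by (rule lipschitz) (use assms in auto)
  moreover have "?w x \<le> 0"
    unfolding chain_dist_def using chain.start[OF assms(2)]
    by (intro cInf_lower) (auto intro!: bdd_belowI[of _ 0] chain_nonneg)
  ultimately show ?thesis by (simp add: dist_commute)
qed

text \<open>The step functions along chains with ever smaller steps have a subsequence that converges to a curve,
  because their jumps vanish in the limit.\<close>

lemma quasiconvex:
  assumes "x \<in> S" "y \<in> S"
  obtains \<gamma> where "lip_path S x y (L * dist x y) \<gamma>"
proof -
  define T where "T = L * dist x y"
  define e where "e k = 1 / real (Suc k)" for k
  have e: "0 < e k" for k by (simp add: e_def)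
  have T: "0 \<le> T" using L_ge_1 by (auto simp: T_def)
  have "\<exists>\<gamma>. \<gamma> 0 = x \<and> \<gamma> T = y \<and> (\<forall>t\<in>{0..T}. \<gamma> t \<in> S) \<and>
    (\<forall>s\<in>{0..T}. \<forall>t\<in>{0..T}. dist (\<gamma> s) (\<gamma> t) \<le> \<bar>s - t\<bar> + 2 * e k)" for k
  proof -
    have "chain_dist S (e k) x y < T + e k"
      using chain_dist_le[OF e[of k] assms] e[of k] by (auto simp: T_def)
    then obtain l where l: "chain S (e k) x y l" "l < T + e k"
      unfolding chain_dist_def using connected_imp_chain[OF connected e[of k] assms]
      by (subst (asm) cInf_less_iff) (auto intro!: bdd_belowI[of _ 0] chain_nonneg)
    obtain \<gamma> where \<gamma>: "\<gamma> 0 = x" "\<gamma> l = y" "\<And>t. 0 \<le> t \<Longrightarrow> t \<le> l \<Longrightarrow> \<gamma> t \<in> S"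
      "\<And>s t. 0 \<le> s \<Longrightarrow> s \<le> t \<Longrightarrow> t \<le> l \<Longrightarrow> dist (\<gamma> s) (\<gamma> t) \<le> t - s + e k"
      using chain_imp_coarse_path[OF l(1) e] by blast
    have l0: "0 \<le> l" using l(1) chain_nonneg by blast
    \<comment> \<open>The chain may be longer than \<^term>\<open>T\<close> by less than \<^term>\<open>e k\<close>.  Cutting it off at \<^term>\<open>T\<close>
      gives all the curves the same parameter interval, at the price of a second jump.\<close>
    let ?\<delta> = "\<lambda>t. if t < T then \<gamma> (min t l) else y"
    have *: "dist (?\<delta> s) (?\<delta> t) \<le> \<bar>s - t\<bar> + 2 * e k" if st: "0 \<le> s" "s \<le> t" "t \<le> T" for s t
    proof (cases "t < T")
      case True
      then show ?thesis using \<gamma>(4)[of "min s l" "min t l"] st l0 e[of k] by (auto simp: min_def split: if_splits)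
    next
      case False
      then have t: "t = T" using st by auto
      show ?thesis
        using \<gamma>(4)[of "min s l" l] st l0 l(2) e[of k] t \<gamma>(2) by (auto simp: min_def split: if_splits)
    qed
    have "?\<delta> 0 = x"
    proof (cases "0 < T")
      case True then show ?thesis using \<gamma>(1) l0 by simp
    next
      case False
      then have "dist x y = 0" using T L_ge_1 by (auto simp: T_def zero_less_mult_iff)
      then show ?thesis using False by simp
    qed
    moreover have "dist (?\<delta> s) (?\<delta> t) \<le> \<bar>s - t\<bar> + 2 * e k" if "s \<in> {0..T}" "t \<in> {0..T}" for s t
    proof (cases "s \<le> t")
      case True then show ?thesis using *[of s t] that by simp
    next
      case False then show ?thesis using *[of t s] that by (simp only: dist_commute) auto
    qed
    moreover have "?\<delta> t \<in> S" if "t \<in> {0..T}" for t using \<gamma>(3)[of "min t l"] that assms l0 by auto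
    ultimately show ?thesis by (intro exI[of _ ?\<delta>]) auto
  qed
  then obtain \<gamma> where \<gamma>: "\<And>k. \<gamma> k 0 = x" "\<And>k. \<gamma> k T = y" "\<And>k t. t \<in> {0..T} \<Longrightarrow> \<gamma> k t \<in> S"
    "\<And>k s t. s \<in> {0..T} \<Longrightarrow> t \<in> {0..T} \<Longrightarrow> dist (\<gamma> k s) (\<gamma> k t) \<le> \<bar>s - t\<bar> + 2 * e k"
    by metis
  have lim: "(\<lambda>k. 2 * e k) \<longlonglongrightarrow> 0"
    unfolding e_def using tendsto_mult_right_zero[OF LIMSEQ_Suc[OF lim_1_over_n]] by simp
  obtain r \<sigma> where r: "strict_mono (r :: nat \<Rightarrow> nat)"
    and \<sigma>: "\<And>t. t \<in> {0..T} \<Longrightarrow> (\<lambda>k. \<gamma> (r k) t) \<longlonglongrightarrow> \<sigma> t" "1-lipschitz_on {0..T} \<sigma>" "\<sigma> ` {0..T} \<subseteq> S"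
    using coarse_Arzela_Ascoli[OF compact T \<gamma>(3,4) lim] by metis
  have "\<sigma> 0 = x" "\<sigma> T = y"
    using \<sigma>(1)[of 0] \<sigma>(1)[of T] \<gamma>(1,2) T by (auto simp: LIMSEQ_const_iff)
  then have "lip_path S x y T \<sigma>" using \<sigma> T by (auto simp: lip_path_def)
  then show thesis using that unfolding T_def by blast
qed

end

lemma ennreal_mult_add: "0 \<le> p \<Longrightarrow> 0 \<le> r \<Longrightarrow> 0 \<le> q \<Longrightarrow> ennreal p * ennreal r + ennreal q = ennreal (p * r + q)"
  by (simp add: ennreal_mult)

context upper_gradient_lipschitz
begin

lemma weighted_dist_bound:
  assumes "\<And>z. z \<in> S \<Longrightarrow> h z \<le> ennreal H" "0 \<le> H" "y \<in> S" "z \<in> S"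
  shows "weighted_dist S h y z \<le> ennreal (H * L * dist y z)"
proof -
  obtain \<gamma> where \<gamma>: "lip_path S y z (L * dist y z) \<gamma>" using quasiconvex assms by blast
  have "weighted_dist S h y z \<le> path_cost (\<lambda>_. ennreal H) (L * dist y z) \<gamma>"
    using weighted_dist_le_path_cost[OF \<gamma>] path_cost_mono[OF \<gamma> assms(1)] by (rule order_trans)
  then show ?thesis
    using L_ge_1 assms(2) by (simp add: path_cost_const[OF \<gamma>] ennreal_mult' mult.assoc)
qed

lemma weighted_dist_diff_le:
  assumes h: "h \<in> borel_measurable (restrict_space borel S)"
    and H: "\<And>z. z \<in> S \<Longrightarrow> h z \<le> ennreal H" "0 \<le> H"
    and "x \<in> S" and \<gamma>: "lip_path S y z T \<gamma>"
  shows "ennreal \<bar>enn2real (weighted_dist S h x y) - enn2real (weighted_dist S h x z)\<bar> \<le> path_cost h T \<gamma>"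
proof -
  have yz: "y \<in> S" "z \<in> S" using \<gamma> by (auto simp: lip_path_def image_subset_iff)
  have fin: "weighted_dist S h x u < top" if "u \<in> S" for u
    using weighted_dist_bound[OF H \<open>x \<in> S\<close> that] by (rule order.strict_trans1) (auto simp: ennreal_less_top)
  have "weighted_dist S h x z \<le> weighted_dist S h x y + path_cost h T \<gamma>"
    by (rule weighted_dist_step[OF \<gamma> h])
  moreover have "weighted_dist S h x y \<le> weighted_dist S h x z + path_cost h T \<gamma>"
    using weighted_dist_step[OF lip_path_reverse[OF \<gamma>] h] path_cost_reverse[OF \<gamma> h] by simp
  ultimately show ?thesis using fin[OF yz(1)] fin[OF yz(2)]
    by (cases "weighted_dist S h x y"; cases "weighted_dist S h x z"; cases "path_cost h T \<gamma>")
       (auto simp flip: ennreal_plus simp: abs_le_iff)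
qed

text \<open>The everywhere bound \<^term>\<open>H\<close> makes the weighted distance continuous, so that the hypothesis
  of the locale applies to it; the resulting Lipschitz constant only sees the almost everywhere
  bound \<^term>\<open>K\<close>.\<close>

lemma weighted_dist_lipschitz:
  assumes h: "h \<in> borel_measurable (restrict_space borel S)"
    and H: "\<And>z. z \<in> S \<Longrightarrow> h z \<le> ennreal H" "0 \<le> H"
    and K: "AE z in \<mu>. h z \<le> ennreal K" "0 \<le> K"
    and "x \<in> S" "y \<in> S" "z \<in> S"
  shows "\<bar>enn2real (weighted_dist S h x y) - enn2real (weighted_dist S h x z)\<bar> \<le> L * K * dist y z"
proof (rule lipschitz[OF _ _ K(2,1)])
  let ?w = "\<lambda>y. enn2real (weighted_dist S h x y)"
  show "upper_gradient S h ?w"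
    by (rule upper_gradientI[OF h weighted_dist_diff_le[OF h H \<open>x \<in> S\<close>]])
  have "\<bar>?w y - ?w z\<bar> \<le> H * L * dist y z" if yz: "y \<in> S" "z \<in> S" for y z
  proof -
    obtain \<gamma> where \<gamma>: "lip_path S y z (L * dist y z) \<gamma>" by (rule quasiconvex[OF yz])
    have "ennreal \<bar>?w y - ?w z\<bar> \<le> path_cost (\<lambda>_. ennreal H) (L * dist y z) \<gamma>"
      using weighted_dist_diff_le[OF h H \<open>x \<in> S\<close> \<gamma>] path_cost_mono[OF \<gamma> H(1)] by (rule order_trans)
    also have "\<dots> = ennreal (H * L * dist y z)"
      using L_ge_1 H(2) by (simp add: path_cost_const[OF \<gamma>] ennreal_mult' mult.assoc)
    finally show ?thesis using L_ge_1 H(2) by (subst (asm) ennreal_le_iff) auto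
  qed
  then have "(H * L)-lipschitz_on S ?w"
    using L_ge_1 H(2) by (intro lipschitz_onI) (auto simp: dist_real_def)
  then show "continuous_on S ?w" by (rule lipschitz_on_continuous_on)
qed fact+

lemma weighted_dist_le:
  assumes h: "h \<in> borel_measurable (restrict_space borel S)"
    and H: "\<And>z. z \<in> S \<Longrightarrow> h z \<le> ennreal H" "0 \<le> H"
    and K: "AE z in \<mu>. h z \<le> ennreal K" "0 \<le> K"
    and "x \<in> S" "y \<in> S"
  shows "weighted_dist S h x y \<le> ennreal (L * K * dist x y)"
proof -
  have "weighted_dist S h x y < top"
    using weighted_dist_bound[OF H assms(6,7)] by (rule order.strict_trans1) (auto simp: ennreal_less_top)
  then show ?thesis
    using weighted_dist_lipschitz[OF h H K assms(6,6,7)] assms(6)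
    by (cases "weighted_dist S h x y") (auto intro!: ennreal_leI)
qed

text \<open>Along a curve, the weighted distance from \<^term>\<open>x\<close> grows at most at the rate \<^term>\<open>k\<close>, its
  upper gradient, and at most at the rate \<^term>\<open>L * K\<close>, its Lipschitz constant, hence also at any
  convex combination of these rates whose coefficients vary continuously.\<close>

lemma weighted_dist_le_convex_combination:
  assumes k: "k \<in> borel_measurable (restrict_space borel S)"
    and H: "\<And>z. z \<in> S \<Longrightarrow> k z \<le> ennreal H" "0 \<le> H"
    and K: "AE z in \<mu>. k z \<le> ennreal K" "0 \<le> K"
    and \<theta>: "continuous_on S \<theta>" "\<And>z. z \<in> S \<Longrightarrow> \<theta> z \<in> {0..1}"
    and \<gamma>: "lip_path S x y T \<gamma>"
  shows "weighted_dist S k x y \<le>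
    path_cost (\<lambda>z. ennreal (1 - \<theta> z) * k z + ennreal (\<theta> z * (L * K))) T \<gamma>"
proof -
  let ?w = "\<lambda>y. enn2real (weighted_dist S k x y)"
  define g where "g z = ennreal (1 - \<theta> z) * k z + ennreal (\<theta> z * (L * K))" for z
  define B where "B = H + L * K"
  have LK: "0 \<le> L * K" using L_ge_1 K(2) by simp
  have B: "0 \<le> B" using H(2) LK by (simp add: B_def)
  have T: "0 \<le> T" and xS: "x \<in> S" "y \<in> S" and in_S: "\<And>t. 0 \<le> t \<Longrightarrow> t \<le> T \<Longrightarrow> \<gamma> t \<in> S"
    and ends: "\<gamma> 0 = x" "\<gamma> T = y" and lip: "1-lipschitz_on {0..T} \<gamma>"
    using \<gamma> by (auto simp: lip_path_def image_subset_iff)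
  have \<theta>_meas: "\<theta> \<in> borel_measurable (restrict_space borel S)"
    using \<theta>(1) by (rule borel_measurable_continuous_on_restrict)
  have g: "g \<in> borel_measurable (restrict_space borel S)"
    unfolding g_def using k \<theta>_meas by measurable
  have g_le: "g z \<le> ennreal B" if "z \<in> S" for z
  proof -
    have "ennreal (1 - \<theta> z) * k z \<le> 1 * ennreal H"
      using \<theta>(2)[OF that] H(1)[OF that] by (intro mult_mono) auto
    moreover have "\<theta> z * (L * K) \<le> 1 * (L * K)" using \<theta>(2)[OF that] LK by (intro mult_right_mono) auto
    then have "ennreal (\<theta> z * (L * K)) \<le> ennreal (L * K)" by (intro ennreal_leI) simp
    ultimately show ?thesis using H(2) LK unfolding g_def B_def by (auto intro: add_mono)
  qed
  define G where "G t = (\<integral>\<^sup>+ u \<in> {0..t}. g (\<gamma> u) \<partial>lborel)" for t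
  have G_fin: "G t < top" if "t \<le> T" for t
  proof -
    have "G t \<le> (\<integral>\<^sup>+ u. ennreal B * indicator {0..t} u \<partial>lborel)"
      unfolding G_def using that g_le in_S by (intro nn_integral_mono) (auto split: split_indicator)
    also have "\<dots> < top" by (cases "0 \<le> t") (auto simp: nn_integral_cmult ennreal_mult_less_top)
    finally show ?thesis .
  qed
  have meas: "(\<lambda>u. g (\<gamma> u) * indicator {s..t} u) \<in> borel_measurable borel" if "0 \<le> s" "t \<le> T" for s t
  proof -
    have "(\<lambda>u. (g (\<gamma> u) * indicator {0..T} u) * indicator {s..t} u) \<in> borel_measurable borel"
      using path_cost_measurable[OF \<gamma> g] by measurable
    also have "(\<lambda>u. (g (\<gamma> u) * indicator {0..T} u) * indicator {s..t} u) = (\<lambda>u. g (\<gamma> u) * indicator {s..t} u)"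
      using that by (auto split: split_indicator)
    finally show ?thesis .
  qed
  have G_add: "G t = G s + (\<integral>\<^sup>+ u \<in> {s..t}. g (\<gamma> u) \<partial>lborel)" if "0 \<le> s" "s \<le> t" "t \<le> T" for s t
  proof -
    have "G s + (\<integral>\<^sup>+ u \<in> {s..t}. g (\<gamma> u) \<partial>lborel) =
      (\<integral>\<^sup>+ u. g (\<gamma> u) * indicator {0..s} u + g (\<gamma> u) * indicator {s..t} u \<partial>lborel)"
      unfolding G_def using that meas[of 0 s] meas[of s t] by (subst nn_integral_add) auto
    also have "\<dots> = G t"
      unfolding G_def using AE_lborel_singleton[of s] that
      by (intro nn_integral_cong_AE) (auto elim!: eventually_mono split: split_indicator)
    finally show ?thesis by simp
  qed
  have "?w y \<le> enn2real (G T) + \<epsilon> * T" if \<epsilon>: "0 < \<epsilon>" for \<epsilon>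
  proof -
    define \<eta> where "\<eta> = \<epsilon> / (B + 1)"
    have \<eta>: "0 < \<eta>" "\<eta> * B \<le> \<epsilon>" using \<epsilon> B by (auto simp: \<eta>_def field_simps)
    have "continuous_on {0..T} (\<lambda>t. \<theta> (\<gamma> t))"
      using in_S lipschitz_on_continuous_on[OF lip] by (intro continuous_on_compose2[OF \<theta>(1)]) auto
    then have "uniformly_continuous_on {0..T} (\<lambda>t. \<theta> (\<gamma> t))"
      by (rule compact_uniformly_continuous) simp
    then obtain d where d: "0 < d"
      "\<And>s t. s \<in> {0..T} \<Longrightarrow> t \<in> {0..T} \<Longrightarrow> \<bar>t - s\<bar> < d \<Longrightarrow> \<bar>\<theta> (\<gamma> t) - \<theta> (\<gamma> s)\<bar> < \<eta>"
      using \<eta>(1) unfolding uniformly_continuous_on_def dist_real_def by metis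
    have "(?w (\<gamma> T) - enn2real (G T)) - (?w (\<gamma> 0) - enn2real (G 0)) \<le> \<epsilon> * T"
    proof (rule increment_le_if_locally_le[OF d(1) T])
      fix s t assume st: "0 \<le> s" "s \<le> t" "t \<le> T" "t - s < d"
      define a where "a = \<theta> (\<gamma> s)"
      have a: "0 \<le> a" "a \<le> 1" using \<theta>(2)[OF in_S[of s]] st by (auto simp: a_def)
      let ?D = "\<bar>?w (\<gamma> s) - ?w (\<gamma> t)\<bar>"
      let ?P = "\<integral>\<^sup>+ u \<in> {s..t}. k (\<gamma> u) \<partial>lborel"
      have sub: "lip_path S (\<gamma> s) (\<gamma> t) (t - s) (\<lambda>u. \<gamma> (s + u))"
        using lip_path_sub[OF \<gamma>] st by simp
      have "ennreal ?D \<le> path_cost k (t - s) (\<lambda>u. \<gamma> (s + u))"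
        by (rule weighted_dist_diff_le[OF k H xS(1) sub])
      also have "\<dots> = ?P"
        using path_cost_translate[OF sub k, of s] by simp
      finally have D1: "ennreal ?D \<le> ?P" .
      have "?D \<le> L * K * dist (\<gamma> s) (\<gamma> t)"
        using weighted_dist_lipschitz[OF k H K xS(1)] in_S st by auto
      also have "\<dots> \<le> L * K * (t - s)"
        using dist_le_lip_path[OF sub] LK by (rule mult_left_mono)
      finally have D2: "?D \<le> L * K * (t - s)" .
      \<comment> \<open>Split the increment in the ratio given by the coefficient at \<^term>\<open>s\<close> and bound each part by
        its own rate.  Replacing this coefficient by the variable one costs at most \<^term>\<open>\<eta> * B\<close> per
        unit of time.\<close>
      have "ennreal ?D = ennreal (1 - a) * ennreal ?D + ennreal (a * ?D)"
      proof -
        have "ennreal (1 - a) * ennreal ?D + ennreal (a * ?D) = ennreal ((1 - a) * ?D + a * ?D)"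
          using a by (simp add: ennreal_mult)
        then show ?thesis by (simp add: left_diff_distrib)
      qed
      also have "\<dots> \<le> ennreal (1 - a) * ?P + ennreal (a * (L * K * (t - s)))"
        using D1 D2 a by (intro add_mono mult_left_mono ennreal_leI) auto
      also have "\<dots> = (\<integral>\<^sup>+ u. ennreal (1 - a) * (k (\<gamma> u) * indicator {s..t} u) +
          ennreal (a * (L * K)) * indicator {s..t} u \<partial>lborel)"
      proof -
        have "(\<lambda>u. (k (\<gamma> u) * indicator {0..T} u) * indicator {s..t} u) \<in> borel_measurable borel"
          using path_cost_measurable[OF \<gamma> k] by measurable
        also have "(\<lambda>u. (k (\<gamma> u) * indicator {0..T} u) * indicator {s..t} u) = (\<lambda>u. k (\<gamma> u) * indicator {s..t} u)"
          using st by (auto split: split_indicator)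
        finally have m: "(\<lambda>u. k (\<gamma> u) * indicator {s..t} u) \<in> borel_measurable lborel" by simp
        have "(\<integral>\<^sup>+ u. ennreal (1 - a) * (k (\<gamma> u) * indicator {s..t} u) +
            ennreal (a * (L * K)) * indicator {s..t} u \<partial>lborel) =
          (\<integral>\<^sup>+ u. ennreal (1 - a) * (k (\<gamma> u) * indicator {s..t} u) \<partial>lborel) +
            (\<integral>\<^sup>+ u. ennreal (a * (L * K)) * indicator {s..t} u \<partial>lborel)"
          using m by (intro nn_integral_add) auto
        also have "\<dots> = ennreal (1 - a) * ?P + ennreal (a * (L * K)) * ennreal (t - s)"
          using st by (intro arg_cong2[where f="(+)"] nn_integral_cmult[OF m]) (simp add: nn_integral_cmult_indicator)
        moreover have "ennreal (a * (L * K * (t - s))) = ennreal (a * (L * K)) * ennreal (t - s)"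
        proof -
          have "0 \<le> a * (L * K)" using a(1) LK by (rule mult_nonneg_nonneg)
          then show ?thesis
            unfolding mult.assoc[of a "L * K" "t - s", symmetric] using st by (intro ennreal_mult) auto
        qed
        ultimately show ?thesis by (simp only:)
      qed
      also have "\<dots> \<le> (\<integral>\<^sup>+ u. g (\<gamma> u) * indicator {s..t} u + ennreal (\<eta> * B) * indicator {s..t} u \<partial>lborel)"
      proof (intro nn_integral_mono)
        fix u
        show "ennreal (1 - a) * (k (\<gamma> u) * indicator {s..t} u) + ennreal (a * (L * K)) * indicator {s..t} u
           \<le> g (\<gamma> u) * indicator {s..t} u + ennreal (\<eta> * B) * indicator {s..t} u"
        proof (cases "u \<in> {s..t}")
          case True
          then have u: "\<gamma> u \<in> S" using in_S st by auto
          have \<theta>u: "\<bar>\<theta> (\<gamma> u) - a\<bar> < \<eta>" "\<theta> (\<gamma> u) \<in> {0..1}"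
            using d(2)[of s u] True st \<theta>(2)[OF u] by (auto simp: a_def)
          obtain r where r: "k (\<gamma> u) = ennreal r" "0 \<le> r" "r \<le> H"
            using H(1)[OF u] H(2) by (cases "k (\<gamma> u)") (auto simp: top_unique)
          have "(\<theta> (\<gamma> u) - a) * r \<le> \<eta> * H" "(a - \<theta> (\<gamma> u)) * (L * K) \<le> \<eta> * (L * K)"
            using \<theta>u r \<eta>(1) H(2) LK by (auto intro!: mult_mono mult_right_mono)
          then have *: "(1 - a) * r + a * (L * K) \<le> ((1 - \<theta> (\<gamma> u)) * r + \<theta> (\<gamma> u) * (L * K)) + \<eta> * B"
            by (simp add: B_def algebra_simps)
          have "ennreal ((1 - a) * r + a * (L * K)) \<le>
              ennreal ((1 - \<theta> (\<gamma> u)) * r + \<theta> (\<gamma> u) * (L * K)) + ennreal (\<eta> * B)"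
          proof -
            have "0 \<le> (1 - \<theta> (\<gamma> u)) * r + \<theta> (\<gamma> u) * (L * K)" "0 \<le> \<eta> * B"
              using \<theta>u(2) r(2) LK \<eta>(1) B by auto
            note ennreal_plus[OF this, symmetric]
            then show ?thesis using * by (simp only: ennreal_leI)
          qed
          moreover have "ennreal (1 - a) * ennreal r + ennreal (a * (L * K)) = ennreal ((1 - a) * r + a * (L * K))"
            using a r(2) LK by (intro ennreal_mult_add) auto
          moreover have "g (\<gamma> u) = ennreal ((1 - \<theta> (\<gamma> u)) * r + \<theta> (\<gamma> u) * (L * K))"
            unfolding g_def r(1) using \<theta>u(2) r(2) LK by (intro ennreal_mult_add) auto
          ultimately show ?thesis using True r(1) by simp
        qed simp
      qed
      also have "\<dots> = (\<integral>\<^sup>+ u \<in> {s..t}. g (\<gamma> u) \<partial>lborel) +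
          (\<integral>\<^sup>+ u. ennreal (\<eta> * B) * indicator {s..t} u \<partial>lborel)"
        using st meas[of s t] by (intro nn_integral_add) auto
      also have "(\<integral>\<^sup>+ u. ennreal (\<eta> * B) * indicator {s..t} u \<partial>lborel) = ennreal (\<eta> * B * (t - s))"
        using st \<eta>(1) B by (subst ennreal_mult) (auto simp: nn_integral_cmult_indicator)
      finally have "ennreal ?D + G s \<le>
          (\<integral>\<^sup>+ u \<in> {s..t}. g (\<gamma> u) \<partial>lborel) + ennreal (\<eta> * B * (t - s)) + G s"
        by (rule add_right_mono)
      also have "\<dots> = G t + ennreal (\<eta> * B * (t - s))"
        unfolding G_add[OF st(1-3)] by (simp only: ac_simps)
      finally have "ennreal ?D + G s \<le> G t + ennreal (\<eta> * B * (t - s))" .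
      moreover obtain p q where "G s = ennreal p" "G t = ennreal q" "0 \<le> p" "0 \<le> q"
        using G_fin[of s] G_fin[of t] st by (cases "G s"; cases "G t") auto
      moreover have "0 \<le> \<eta> * B * (t - s)" using \<eta>(1) B st by (intro mult_nonneg_nonneg) auto
      ultimately have "?D + enn2real (G s) \<le> enn2real (G t) + \<eta> * B * (t - s)"
        by (simp add: ennreal_plus[symmetric] del: ennreal_plus)
      also have "\<eta> * B * (t - s) \<le> \<epsilon> * (t - s)" using \<eta>(2) st by (intro mult_right_mono) auto
      finally show "(?w (\<gamma> t) - enn2real (G t)) - (?w (\<gamma> s) - enn2real (G s)) \<le> \<epsilon> * (t - s)" by simp
    qed
    moreover have "G 0 = 0" using G_add[of 0 0] T G_fin[of 0] by (cases "G 0") (auto simp: G_def)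
    ultimately show ?thesis using xS by (simp add: ends)
  qed
  note eps = this
  have "?w y \<le> enn2real (G T) + \<epsilon>" if "0 < \<epsilon>" for \<epsilon>
  proof -
    have "?w y \<le> enn2real (G T) + \<epsilon> / (T + 1) * T" using that T by (intro eps) auto
    moreover have "\<epsilon> / (T + 1) * T \<le> \<epsilon>" using that T by (simp add: field_simps)
    ultimately show ?thesis by linarith
  qed
  then have "?w y \<le> enn2real (G T)" by (rule field_le_epsilon)
  moreover have "weighted_dist S k x y < top"
    using weighted_dist_bound[OF H xS] by (rule order.strict_trans1) (auto simp: ennreal_less_top)
  ultimately have "weighted_dist S k x y \<le> G T"
    using G_fin[of T] by (cases "weighted_dist S k x y"; cases "G T") auto
  then show ?thesis unfolding G_def g_def path_cost_def .
qed

text \<open>On an open set, a weight may be replaced by the constant \<^term>\<open>L * K\<close>, however large it is on a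
  null subset: the coefficients of the previous lemma can be chosen to increase to the indicator
  function of the open set.\<close>

lemma weighted_dist_le_replace:
  assumes k: "k \<in> borel_measurable (restrict_space borel S)"
    and H: "\<And>z. z \<in> S \<Longrightarrow> k z \<le> ennreal H" "0 \<le> H"
    and K: "AE z in \<mu>. k z \<le> ennreal K" "0 \<le> K"
    and "open U"
  shows "weighted_dist S k x y \<le> weighted_dist S (\<lambda>z. if z \<in> U then ennreal (L * K) else k z) x y"
proof -
  have LK: "0 \<le> L * K" using L_ge_1 K(2) by simp
  define V where "V = - U"
  have V: "closed V" using \<open>open U\<close> by (simp add: V_def closed_Compl)
  \<comment> \<open>The distance to the empty set is zero by convention, so this case is separate.\<close>
  define \<theta> where "\<theta> n z = (if V = {} then 1 else min 1 (real n * infdist z V))" for n z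
  have \<theta>_cont: "continuous_on S (\<theta> n)" for n
    unfolding \<theta>_def by (cases "V = {}") (auto intro!: continuous_intros)
  have \<theta>_range: "\<theta> n z \<in> {0..1}" for n z by (auto simp: \<theta>_def infdist_nonneg)
  have \<theta>_out: "\<theta> n z = 0" if "z \<notin> U" for n z using that by (auto simp: \<theta>_def V_def)
  have \<theta>_in: "\<forall>\<^sub>F n in sequentially. \<theta> n z = 1" if "z \<in> U" for z
  proof (cases "V = {}")
    case False
    then have "0 < infdist z V"
      using in_closed_iff_infdist_zero[OF V False, of z] infdist_nonneg[of z V] that
      by (auto simp: V_def less_le)
    then obtain N :: nat where N: "1 < real N * infdist z V" using reals_Archimedean3 by blast
    have "\<theta> n z = 1" if "n \<ge> N" for n
    proof -
      have "real N * infdist z V \<le> real n * infdist z V"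
        using that \<open>0 < infdist z V\<close> by (intro mult_right_mono) auto
      then show ?thesis using N False by (auto simp: \<theta>_def)
    qed
    then show ?thesis by (auto simp: eventually_sequentially)
  qed (simp add: \<theta>_def)
  let ?k' = "\<lambda>z. if z \<in> U then ennreal (L * K) else k z"
  define g where "g n z = ennreal (1 - \<theta> n z) * k z + ennreal (\<theta> n z * (L * K))" for n z
  have g_meas: "g n \<in> borel_measurable (restrict_space borel S)" for n
  proof -
    have "\<theta> n \<in> borel_measurable (restrict_space borel S)"
      using \<theta>_cont by (rule borel_measurable_continuous_on_restrict)
    then show ?thesis unfolding g_def using k by measurable
  qed
  have k'_meas: "?k' \<in> borel_measurable (restrict_space borel S)"
  proof -
    have "{z \<in> space (restrict_space borel S). z \<in> U} \<in> sets (restrict_space borel S)"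
      using \<open>open U\<close> by (auto simp: space_restrict_space sets_restrict_space)
    then show ?thesis using k by (intro measurable_If) auto
  qed
  have "weighted_dist S k x y \<le> path_cost ?k' T \<gamma>" if \<gamma>: "lip_path S x y T \<gamma>" for T \<gamma>
  proof -
    have in_S: "\<gamma> t \<in> S" if "t \<in> {0..T}" for t using \<gamma> that by (auto simp: lip_path_def)
    have lim: "(\<lambda>n. path_cost (g n) T \<gamma>) \<longlonglongrightarrow> path_cost ?k' T \<gamma>"
      unfolding path_cost_def
    proof (rule nn_integral_dominated_convergence[where w = "\<lambda>t. ennreal (H + L * K) * indicator {0..T} t"])
      show "AE t in lborel. g n (\<gamma> t) * indicator {0..T} t \<le> ennreal (H + L * K) * indicator {0..T} t" for n
      proof (intro AE_I2)
        fix t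
        have "g n (\<gamma> t) \<le> 1 * ennreal H + ennreal (L * K)" if t: "t \<in> {0..T}"
        proof -
          have "\<theta> n (\<gamma> t) * (L * K) \<le> 1 * (L * K)"
            using \<theta>_range[of n "\<gamma> t"] LK by (intro mult_right_mono) auto
          then have "ennreal (\<theta> n (\<gamma> t) * (L * K)) \<le> ennreal (L * K)" by (intro ennreal_leI) simp
          moreover have "ennreal (1 - \<theta> n (\<gamma> t)) * k (\<gamma> t) \<le> 1 * ennreal H"
            using \<theta>_range[of n "\<gamma> t"] H(1)[OF in_S[OF t]] by (intro mult_mono) auto
          ultimately show ?thesis unfolding g_def by (intro add_mono)
        qed
        then show "g n (\<gamma> t) * indicator {0..T} t \<le> ennreal (H + L * K) * indicator {0..T} t"
          using H(2) LK by (auto split: split_indicator)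
      qed
      show "(\<integral>\<^sup>+ t. ennreal (H + L * K) * indicator {0..T} t \<partial>lborel) < \<infinity>"
        using \<gamma> by (auto simp: nn_integral_cmult lip_path_def ennreal_mult_less_top)
      show "AE t in lborel. (\<lambda>n. g n (\<gamma> t) * indicator {0..T} t) \<longlonglongrightarrow> ?k' (\<gamma> t) * indicator {0..T} t"
      proof (intro AE_I2)
        fix t
        have "\<forall>\<^sub>F n in sequentially. g n (\<gamma> t) = ?k' (\<gamma> t)"
        proof (cases "\<gamma> t \<in> U")
          case True
          from \<theta>_in[OF True] show ?thesis by eventually_elim (simp add: g_def True)
        qed (simp add: g_def \<theta>_out)
        then have "\<forall>\<^sub>F n in sequentially. g n (\<gamma> t) * indicator {0..T} t = ?k' (\<gamma> t) * indicator {0..T} t"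
          by (rule eventually_mono) simp
        then show "(\<lambda>n. g n (\<gamma> t) * indicator {0..T} t) \<longlonglongrightarrow> ?k' (\<gamma> t) * indicator {0..T} t"
          by (rule tendsto_eventually)
      qed
    qed (use path_cost_measurable[OF \<gamma> g_meas] path_cost_measurable[OF \<gamma> k'_meas] in auto)
    have "weighted_dist S k x y \<le> path_cost (g n) T \<gamma>" for n
      using weighted_dist_le_convex_combination[OF k H K \<theta>_cont \<theta>_range \<gamma>] unfolding g_def .
    then show ?thesis by (intro LIMSEQ_le_const[OF lim]) auto
  qed
  then show ?thesis unfolding weighted_dist_def[of S ?k'] by (intro INF_greatest) auto
qed

end

section \<open>Curves that spend no time in a null set\<close>

lemma const_indicator_measurable:
  assumes [measurable]: "A \<in> sets borel"
  shows "(\<lambda>z. ennreal M * indicator A z) \<in> borel_measurable (restrict_space borel S)"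
  by (intro measurable_restrict_space1) measurable

lemma INT_open_borel: "(\<And>i::nat. open (U i)) \<Longrightarrow> (\<Inter>i. U i) \<in> sets borel"
  by (intro sets.countable_INT) auto

context upper_gradient_lipschitz
begin

text \<open>Admitting all penalties \<open>M\<close> makes the property inherited by enlarged weights: adding an indicator
  function to the weight consumes some finite penalty, and arbitrary ones are still left.\<close>

definition robust_weight :: "(nat \<Rightarrow> 'a set) \<Rightarrow> 'a \<Rightarrow> 'a \<Rightarrow> ('a \<Rightarrow> ennreal) \<Rightarrow> real \<Rightarrow> bool" where
  "robust_weight U x y h c \<longleftrightarrow>
     h \<in> borel_measurable (restrict_space borel S) \<and> (\<exists>H\<ge>0. \<forall>z\<in>S. h z \<le> ennreal H) \<and>
     (\<forall>M\<ge>0. weighted_dist S (\<lambda>z. h z + ennreal M * indicator (\<Inter>i. U i) z) x y \<le> ennreal c)"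

lemma robust_weight_mono:
  assumes h: "robust_weight U x y h c" and "c \<le> c'"
  shows "robust_weight U x y h c'"
proof -
  have "weighted_dist S (\<lambda>z. h z + ennreal M * indicator (\<Inter>i. U i) z) x y \<le> ennreal c'" if "0 \<le> M" for M
    using h that ennreal_leI[OF assms(2)] unfolding robust_weight_def by (meson order_trans)
  then show ?thesis using h unfolding robust_weight_def by blast
qed

lemma robust_weight_one:
  assumes U: "\<And>i. open (U i)" and null: "AE z in \<mu>. z \<notin> (\<Inter>i. U i)" and "x \<in> S" "y \<in> S"
  shows "robust_weight U x y (\<lambda>_. 1) (L * dist x y)"
  unfolding robust_weight_def
proof (intro conjI allI impI)
  fix M :: real assume M: "0 \<le> M"
  have "weighted_dist S (\<lambda>z. 1 + ennreal M * indicator (\<Inter>i. U i) z) x y \<le> ennreal (L * 1 * dist x y)"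
  proof (rule weighted_dist_le)
    show "(\<lambda>z. 1 + ennreal M * indicator (\<Inter>i. U i) z) \<in> borel_measurable (restrict_space borel S)"
      using const_indicator_measurable[OF INT_open_borel[OF U]] by measurable
    show "1 + ennreal M * indicator (\<Inter>i. U i) z \<le> ennreal (1 + M)" for z
      using M by (auto split: split_indicator)
    show "AE z in \<mu>. 1 + ennreal M * indicator (\<Inter>i. U i) z \<le> ennreal 1"
      using null by eventually_elim simp
  qed (use M assms in auto)
  then show "weighted_dist S (\<lambda>z. 1 + ennreal M * indicator (\<Inter>i. U i) z) x y \<le> ennreal (L * dist x y)"
    by simp
qed (auto intro!: exI[of _ 1])

text \<open>A nearly optimal curve for a large multiple of the indicator of the null set stays nearly optimal
  if the null set is thickened to some \<^term>\<open>U n\<close>.  By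
  \<open>weighted_dist_le_replace\<close>, inside \<^term>\<open>U n\<close> the new weight with an arbitrary penalty on the
  null set may be replaced by a constant that does not depend on the penalty.\<close>

lemma robust_weight_step:
  assumes U: "\<And>i. open (U i)" "decseq U" and null: "AE z in \<mu>. z \<notin> (\<Inter>i. U i)"
    and h: "robust_weight U x y h c" and "0 \<le> c" "0 < \<epsilon>"
  obtains n where "robust_weight U x y (\<lambda>z. h z + indicator (U n) z) (c + \<epsilon>)"
proof -
  let ?N = "\<Inter>i. U i"
  obtain H where H: "0 \<le> H" "\<And>z. z \<in> S \<Longrightarrow> h z \<le> ennreal H"
    and h_meas: "h \<in> borel_measurable (restrict_space borel S)"
    and h_le: "\<And>M. 0 \<le> M \<Longrightarrow> weighted_dist S (\<lambda>z. h z + ennreal M * indicator ?N z) x y \<le> ennreal c"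
    using h by (auto simp: robust_weight_def)
  note ind_meas = const_indicator_measurable
  have N_meas: "?N \<in> sets borel" using INT_open_borel[OF U(1)] .
  \<comment> \<open>The new weight is almost everywhere at most \<^term>\<open>H + 1\<close>, so \<^term>\<open>L * (H + 1)\<close> is its
    replacement on the open set.\<close>
  define m where "m = L * (H + 1)"
  have m: "0 \<le> m" using H(1) L_ge_1 by (simp add: m_def)
  have "weighted_dist S (\<lambda>z. h z + ennreal m * indicator ?N z) x y < ennreal (c + \<epsilon>)"
    using \<open>0 \<le> c\<close> \<open>0 < \<epsilon>\<close> by (intro order.strict_trans1[OF h_le[OF m]] ennreal_lessI) auto
  then obtain T \<gamma> where \<gamma>: "lip_path S x y T \<gamma>"
    and less: "path_cost (\<lambda>z. h z + ennreal m * indicator ?N z) T \<gamma> < ennreal (c + \<epsilon>)"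
    by (rule weighted_dist_lessE)
  have in_S: "\<gamma> t \<in> S" if "t \<in> {0..T}" for t using \<gamma> that by (auto simp: lip_path_def)
  have "(\<lambda>n. path_cost (\<lambda>z. h z + ennreal m * indicator (U n) z) T \<gamma>)
      \<longlonglongrightarrow> path_cost (\<lambda>z. h z + ennreal m * indicator ?N z) T \<gamma>"
    unfolding path_cost_def
  proof (rule nn_integral_dominated_convergence[where w = "\<lambda>t. ennreal (H + m) * indicator {0..T} t"])
    show "AE t in lborel. (h (\<gamma> t) + ennreal m * indicator (U n) (\<gamma> t)) * indicator {0..T} t
        \<le> ennreal (H + m) * indicator {0..T} t" for n
    proof (intro AE_I2)
      fix t
      have "h (\<gamma> t) + ennreal m * indicator (U n) (\<gamma> t) \<le> ennreal H + ennreal m" if "t \<in> {0..T}"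
        using H(2)[OF in_S[OF that]] by (intro add_mono) (auto split: split_indicator)
      then show "(h (\<gamma> t) + ennreal m * indicator (U n) (\<gamma> t)) * indicator {0..T} t
          \<le> ennreal (H + m) * indicator {0..T} t"
        using H(1) m by (auto split: split_indicator)
    qed
    show "(\<integral>\<^sup>+ t. ennreal (H + m) * indicator {0..T} t \<partial>lborel) < \<infinity>"
      using \<gamma> by (auto simp: nn_integral_cmult lip_path_def ennreal_mult_less_top)
    show "AE t in lborel. (\<lambda>n. (h (\<gamma> t) + ennreal m * indicator (U n) (\<gamma> t)) * indicator {0..T} t)
        \<longlonglongrightarrow> (h (\<gamma> t) + ennreal m * indicator ?N (\<gamma> t)) * indicator {0..T} t"
    proof (intro AE_I2 tendsto_eventually)
      fix t
      have "\<forall>\<^sub>F n in sequentially. \<gamma> t \<in> U n \<longleftrightarrow> \<gamma> t \<in> ?N"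
      proof (cases "\<gamma> t \<in> ?N")
        case False
        then obtain n where "\<gamma> t \<notin> U n" by auto
        then have "\<gamma> t \<notin> U i" if "i \<ge> n" for i using decseqD[OF U(2) that] by auto
        then show ?thesis using False by (auto simp: eventually_sequentially)
      qed auto
      then show "\<forall>\<^sub>F n in sequentially. (h (\<gamma> t) + ennreal m * indicator (U n) (\<gamma> t)) * indicator {0..T} t
          = (h (\<gamma> t) + ennreal m * indicator ?N (\<gamma> t)) * indicator {0..T} t"
        by eventually_elim (auto simp: indicator_def)
    qed
  next
    have "(\<lambda>z. h z + ennreal m * indicator A z) \<in> borel_measurable (restrict_space borel S)"
      if "A \<in> sets borel" for A
      using h_meas ind_meas[OF that] by (rule borel_measurable_add)
    from path_cost_measurable[OF \<gamma> this]
    show "(\<lambda>t. (h (\<gamma> t) + ennreal m * indicator (U n) (\<gamma> t)) * indicator {0..T} t) \<in> borel_measurable lborel"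
      "(\<lambda>t. (h (\<gamma> t) + ennreal m * indicator ?N (\<gamma> t)) * indicator {0..T} t) \<in> borel_measurable lborel" for n
      using U(1) N_meas by auto
  qed simp
  from order_tendstoD(2)[OF this less]
  obtain n where n: "path_cost (\<lambda>z. h z + ennreal m * indicator (U n) z) T \<gamma> < ennreal (c + \<epsilon>)"
    by (auto simp: eventually_sequentially)
  have "robust_weight U x y (\<lambda>z. h z + indicator (U n) z) (c + \<epsilon>)"
    unfolding robust_weight_def
  proof (intro conjI allI impI)
    have le: "h z + indicator (U n) z \<le> ennreal (H + 1)" if "z \<in> S" for z
      using H(1) H(2)[OF that] by (auto split: split_indicator intro: add_increasing2 add_mono)
    show meas: "(\<lambda>z. h z + indicator (U n) z) \<in> borel_measurable (restrict_space borel S)"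
      using ind_meas[of "U n" 1 S] h_meas U(1) by simp
    show "\<exists>H\<ge>0. \<forall>z\<in>S. h z + indicator (U n) z \<le> ennreal H"
      using le H(1) by (intro exI[of _ "H + 1"]) auto
    fix M :: real assume M: "0 \<le> M"
    let ?k = "\<lambda>z. h z + indicator (U n) z + ennreal M * indicator ?N z"
    let ?k' = "\<lambda>z. if z \<in> U n then ennreal (L * (H + 1)) else ?k z"
    have "weighted_dist S ?k x y \<le> weighted_dist S ?k' x y"
    proof (rule weighted_dist_le_replace)
      show "?k \<in> borel_measurable (restrict_space borel S)"
        using meas ind_meas[OF N_meas] by measurable
      show "?k z \<le> ennreal (H + 1 + M)" if "z \<in> S" for z
        using le[OF that] M H(1)
        by (auto split: split_indicator intro: add_mono add_increasing2 simp: ennreal_plus simp del: ennreal_plus[symmetric])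
      show "AE z in \<mu>. ?k z \<le> ennreal (H + 1)"
        using null AE_space by eventually_elim (use le space_eq in auto)
    qed (use H(1) M U(1) in auto)
    also have "\<dots> \<le> path_cost ?k' T \<gamma>" by (rule weighted_dist_le_path_cost[OF \<gamma>])
    also have "\<dots> \<le> path_cost (\<lambda>z. h z + ennreal m * indicator (U n) z) T \<gamma>"
    proof (rule path_cost_mono[OF \<gamma>])
      fix z assume "z \<in> S"
      have "ennreal (L * (H + 1)) \<le> ennreal m" by (intro ennreal_leI) (simp add: m_def)
      then show "?k' z \<le> h z + ennreal m * indicator (U n) z"
        by (auto split: split_indicator intro: add_increasing)
    qed
    finally show "weighted_dist S ?k x y \<le> ennreal (c + \<epsilon>)" using n by simp
  qed
  then show thesis by (rule that)
qed


text \<open>Iterating the previous step, with total loss \<^term>\<open>dist x y\<close>, gives weights that increase to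
  infinity on the null set, while curves from \<^term>\<open>x\<close> to \<^term>\<open>y\<close> of bounded cost exist for
  each of them.\<close>

lemma robust_weights_exist:
  assumes U: "\<And>i. open (U i)" "decseq U" and null: "AE z in \<mu>. z \<notin> (\<Inter>i. U i)"
    and xy: "x \<in> S" "y \<in> S" "x \<noteq> y"
  obtains n :: "nat \<Rightarrow> nat"
  where "\<And>k. robust_weight U x y (\<lambda>z. 1 + (\<Sum>i<k. indicator (U (n i)) z)) ((L + 1) * dist x y)"
proof -
  define d where "d = dist x y"
  have d: "0 < d" using xy by (simp add: d_def)
  define c where "c k = L * d + d * (1 - (1/2)^k)" for k :: nat
  have c: "0 \<le> c k" "c k \<le> (L + 1) * d" for k
  proof -
    have "0 \<le> (1/2::real)^k" "(1/2)^k \<le> (1::real)" by (auto intro: power_le_one)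
    then have "0 \<le> d * (1 - (1/2)^k)" "d * (1 - (1/2)^k) \<le> d * 1"
      using d by (intro mult_nonneg_nonneg mult_left_mono; linarith)+
    moreover have "0 \<le> L * d" using d L_ge_1 by simp
    ultimately show "0 \<le> c k" "c k \<le> (L + 1) * d"
      by (simp_all add: c_def distrib_right)
  qed
  have c_Suc: "c (Suc k) = c k + d * (1/2)^Suc k" for k by (simp add: c_def algebra_simps)
  have "\<exists>h. \<forall>k. (robust_weight U x y (h k) (c k) \<and> (k = 0 \<longrightarrow> h k = (\<lambda>_. 1))) \<and>
      (\<exists>n. h (Suc k) = (\<lambda>z. h k z + indicator (U n) z))"
  proof (rule dependent_nat_choice)
    show "\<exists>h. robust_weight U x y h (c 0) \<and> (0 = (0::nat) \<longrightarrow> h = (\<lambda>_. 1))"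
      using robust_weight_one[OF U(1) null xy(1,2)] by (intro exI[of _ "\<lambda>_. 1"]) (simp add: c_def d_def)
  next
    fix h and k :: nat assume "robust_weight U x y h (c k) \<and> (k = 0 \<longrightarrow> h = (\<lambda>_. 1))"
    then have h: "robust_weight U x y h (c k)" by simp
    define \<epsilon> where "\<epsilon> = d * (1/2)^Suc k"
    have \<epsilon>: "0 < \<epsilon>" using d by (simp add: \<epsilon>_def)
    obtain n where "robust_weight U x y (\<lambda>z. h z + indicator (U n) z) (c k + \<epsilon>)"
      by (rule robust_weight_step[OF U null h c(1) \<epsilon>])
    then have "robust_weight U x y (\<lambda>z. h z + indicator (U n) z) (c (Suc k))"
      unfolding c_Suc \<epsilon>_def .
    then show "\<exists>h'. (robust_weight U x y h' (c (Suc k)) \<and> (Suc k = 0 \<longrightarrow> h' = (\<lambda>_. 1))) \<and>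
        (\<exists>n. h' = (\<lambda>z. h z + indicator (U n) z))"
      by (intro exI[of _ "\<lambda>z. h z + indicator (U n) z"] conjI exI[of _ n] impI refl) simp_all
  qed
  then obtain h where all: "\<forall>k. (robust_weight U x y (h k) (c k) \<and> (k = 0 \<longrightarrow> h k = (\<lambda>_. 1))) \<and>
      (\<exists>n. h (Suc k) = (\<lambda>z. h k z + indicator (U n) z))" by (rule exE)
  then have h: "robust_weight U x y (h k) (c k)" "h 0 = (\<lambda>_. 1)" for k by blast+
  from all have "\<forall>k. \<exists>n. h (Suc k) = (\<lambda>z. h k z + indicator (U n) z)" by blast
  from choice[OF this] obtain n where n: "\<And>k. h (Suc k) = (\<lambda>z. h k z + indicator (U (n k)) z)"
    by blast
  have "h k = (\<lambda>z. 1 + (\<Sum>i<k. indicator (U (n i)) z))" for k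
  proof (induction k)
    case (Suc k)
    have "h (Suc k) z = 1 + (\<Sum>i<Suc k. indicator (U (n i)) z)" for z
      by (simp only: n Suc.IH sum.lessThan_Suc add.assoc)
    then show ?case by auto
  qed (simp add: h)
  moreover have "robust_weight U x y (h k) ((L + 1) * d)" for k
    by (rule robust_weight_mono[OF h(1) c(2)])
  ultimately have "robust_weight U x y (\<lambda>z. 1 + (\<Sum>i<k. indicator (U (n i)) z)) ((L + 1) * d)" for k
    by (simp only:)
  then show thesis unfolding d_def by (rule that)
qed

text \<open>The weights are lower semicontinuous, so by Fatou's lemma a limit of curves with bounded cost has
  bounded cost for all of them.  As they tend to infinity on the null set, the limit curve is in it
  only for a set of times of measure zero.\<close>

lemma path_avoiding_null_set:
  assumes U: "\<And>i. open (U i)" "decseq U" and null: "AE z in \<mu>. z \<notin> (\<Inter>i. U i)"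
    and xy: "x \<in> S" "y \<in> S" "x \<noteq> y"
  obtains T \<sigma> where "lip_path S x y T \<sigma>" "T \<le> (L + 2) * dist x y"
    "AE t in lborel. t \<in> {0..T} \<longrightarrow> \<sigma> t \<notin> (\<Inter>i. U i)"
proof -
  let ?N = "\<Inter>i. U i"
  define c where "c = (L + 2) * dist x y"
  have c: "(L + 1) * dist x y < c" "0 < c" "0 \<le> c" using xy L_ge_1 by (auto simp: c_def)
  obtain n :: "nat \<Rightarrow> nat" where
    n: "\<And>k. robust_weight U x y (\<lambda>z. 1 + (\<Sum>i<k. indicator (U (n i)) z)) ((L + 1) * dist x y)"
    using robust_weights_exist[OF U null xy] by blast
  define h :: "nat \<Rightarrow> 'a \<Rightarrow> ennreal" where "h k z = 1 + (\<Sum>i<k. indicator (U (n i)) z)" for k z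
  have h_meas: "h k \<in> borel_measurable (restrict_space borel S)" for k
    using n[of k] unfolding robust_weight_def h_def by simp
  have h_mono: "h j z \<le> h k z" if "j \<le> k" for j k z
    unfolding h_def using that by (intro add_left_mono sum_mono2) auto
  have h_N: "of_nat k \<le> h k z" if "z \<in> ?N" for k z
    using that by (simp add: h_def)
  have "\<exists>T \<gamma>. lip_path S x y T \<gamma> \<and> path_cost (h k) T \<gamma> < ennreal c" for k
  proof -
    have "weighted_dist S (\<lambda>z. h k z + ennreal 0 * indicator ?N z) x y \<le> ennreal ((L + 1) * dist x y)"
      using n[of k] unfolding robust_weight_def h_def by blast
    also have "\<dots> < ennreal c" using c L_ge_1 by (intro ennreal_lessI) auto
    finally show ?thesis by (auto elim!: weighted_dist_lessE)
  qed
  then obtain T \<gamma> where \<gamma>: "\<And>k. lip_path S x y (T k) (\<gamma> k)"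
    and cost: "\<And>k. path_cost (h k) (T k) (\<gamma> k) < ennreal c"
    by metis
  have T: "T k \<in> {0..c}" for k
  proof -
    have "path_cost (\<lambda>_. 1) (T k) (\<gamma> k) \<le> path_cost (h k) (T k) (\<gamma> k)"
      by (rule path_cost_mono[OF \<gamma>]) (simp add: h_def)
    then have "ennreal (T k) < ennreal c"
      using cost[of k] by (simp add: path_cost_const[OF \<gamma>])
    then show ?thesis using \<gamma>[of k] by (auto simp: lip_path_def ennreal_less_iff)
  qed
  \<comment> \<open>Let the curves rest at \<^term>\<open>y\<close>, so that they have a common parameter interval.  The cost is
    still taken over the original intervals.\<close>
  define \<delta> where "\<delta> k t = \<gamma> k (min t (T k))" for k t
  have \<delta>_in: "\<delta> k t \<in> S" if "t \<in> {0..c}" for k t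
    using \<gamma>[of k] T[of k] that by (auto simp: \<delta>_def lip_path_def image_subset_iff)
  have \<delta>_lip: "dist (\<delta> k s) (\<delta> k t) \<le> \<bar>s - t\<bar> + 0" if "s \<in> {0..c}" "t \<in> {0..c}" for k s t
  proof -
    have "dist (\<delta> k s) (\<delta> k t) \<le> \<bar>min s (T k) - min t (T k)\<bar>"
      unfolding \<delta>_def using \<gamma>[of k] T[of k] that lipschitz_onD[of 1 "{0..T k}" "\<gamma> k" "min s (T k)" "min t (T k)"]
      by (auto simp: lip_path_def dist_real_def)
    also have "\<dots> \<le> \<bar>s - t\<bar>" by (auto simp: min_def)
    finally show ?thesis by simp
  qed
  obtain T' r where r: "strict_mono (r :: nat \<Rightarrow> nat)" and T': "T' \<in> {0..c}" "(\<lambda>k. T (r k)) \<longlonglongrightarrow> T'"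
    using compact_imp_seq_compact[OF compact_Icc[of 0 c]] T unfolding seq_compact_def o_def by metis
  obtain q \<sigma> where q: "strict_mono (q :: nat \<Rightarrow> nat)"
    and \<sigma>: "\<And>t. t \<in> {0..c} \<Longrightarrow> (\<lambda>k. \<delta> (r (q k)) t) \<longlonglongrightarrow> \<sigma> t"
      "1-lipschitz_on {0..c} \<sigma>" "\<sigma> ` {0..c} \<subseteq> S"
    using coarse_Arzela_Ascoli[OF compact c(3), of "\<lambda>k. \<delta> (r k)" "\<lambda>_. 0"] \<delta>_in \<delta>_lip by auto
  define p where "p k = r (q k)" for k
  have p: "k \<le> p k" for k
    using seq_suble[OF strict_mono_o[OF r q], of k] by (simp add: p_def)
  have Tp: "(\<lambda>k. T (p k)) \<longlonglongrightarrow> T'"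
    using LIMSEQ_subseq_LIMSEQ[OF T'(2) q] by (simp add: p_def o_def)
  have \<sigma>_lim: "(\<lambda>k. \<delta> (p k) t) \<longlonglongrightarrow> \<sigma> t" if "t \<in> {0..c}" for t using \<sigma>(1)[OF that] by (simp add: p_def)
  have "\<sigma> 0 = x"
  proof -
    have "\<delta> k 0 = x" for k using \<gamma>[of k] T[of k] by (auto simp: \<delta>_def lip_path_def)
    then show ?thesis using \<sigma>_lim[of 0] c by (auto simp: LIMSEQ_const_iff)
  qed
  moreover have "\<sigma> T' = y"
  proof -
    have "dist (\<delta> k T') y \<le> \<bar>T' - T k\<bar>" for k
      using \<delta>_lip[OF T'(1) T[of k], of k] \<gamma>[of k] by (auto simp: \<delta>_def lip_path_def)
    moreover have "(\<lambda>k. \<bar>T' - T (p k)\<bar>) \<longlonglongrightarrow> \<bar>T' - T'\<bar>" by (intro tendsto_intros Tp)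
    moreover have "(\<lambda>k. dist (\<delta> (p k) T') y) \<longlonglongrightarrow> dist (\<sigma> T') y"
      by (intro tendsto_intros \<sigma>_lim T')
    ultimately have "dist (\<sigma> T') y \<le> \<bar>T' - T'\<bar>" by (intro LIMSEQ_le) auto
    then show ?thesis by simp
  qed
  ultimately have path: "lip_path S x y T' \<sigma>"
    using T' \<sigma>(3) lipschitz_on_subset[OF \<sigma>(2), of "{0..T'}"] by (auto simp: lip_path_def)
  have cost': "path_cost (h j) T' \<sigma> \<le> ennreal c" for j
  proof -
    define u where "u k t = h j (\<gamma> (p k) t) * indicator {0..T (p k)} t" for k t
    \<comment> \<open>A time before \<^term>\<open>T'\<close> eventually belongs to the intervals of the approximating curves, but
      \<^term>\<open>T'\<close> itself need not.\<close>
    have le: "h j (\<sigma> t) * indicator {0..T'} t \<le> liminf (\<lambda>k. u k t)" if "t \<noteq> T'" for t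
    proof (cases "t \<in> {0..T'}")
      case True
      then have t: "0 \<le> t" "t < T'" "t \<in> {0..c}" using that T' by auto
      have "\<forall>\<^sub>F k in sequentially. \<forall>i\<in>{..<j}. \<sigma> t \<in> U (n i) \<longrightarrow> \<delta> (p k) t \<in> U (n i)"
        using topological_tendstoD[OF \<sigma>_lim[OF t(3)] U(1)]
        by (intro eventually_ball_finite) auto
      moreover have "\<forall>\<^sub>F k in sequentially. t < T (p k)" by (rule order_tendstoD(1)[OF Tp t(2)])
      ultimately have "\<forall>\<^sub>F k in sequentially. h j (\<sigma> t) \<le> u k t"
      proof eventually_elim
        case (elim k)
        then have "\<delta> (p k) t = \<gamma> (p k) t" by (simp add: \<delta>_def)
        then have "h j (\<sigma> t) \<le> h j (\<gamma> (p k) t)"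
          using elim(1) unfolding h_def by (intro add_left_mono sum_mono) (auto split: split_indicator)
        then show ?case using elim(2) t by (simp add: u_def)
      qed
      then have "h j (\<sigma> t) \<le> liminf (\<lambda>k. u k t)" by (rule Liminf_bounded)
      then show ?thesis using True by simp
    qed simp
    have "path_cost (h j) T' \<sigma> \<le> (\<integral>\<^sup>+ t. liminf (\<lambda>k. u k t) \<partial>lborel)"
      unfolding path_cost_def using AE_lborel_singleton[of T']
      by (intro nn_integral_mono_AE) (auto elim!: eventually_mono intro: le)
    also have "\<dots> \<le> liminf (\<lambda>k. \<integral>\<^sup>+ t. u k t \<partial>lborel)"
      using path_cost_measurable[OF \<gamma> h_meas] unfolding u_def by (intro nn_integral_liminf) auto
    also have "\<dots> \<le> ennreal c"
    proof (rule Liminf_le)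
      have "(\<integral>\<^sup>+ t. u k t \<partial>lborel) \<le> ennreal c" if "j \<le> k" for k
      proof -
        have "path_cost (h j) (T (p k)) (\<gamma> (p k)) \<le> path_cost (h (p k)) (T (p k)) (\<gamma> (p k))"
          using h_mono that p[of k] by (intro path_cost_mono[OF \<gamma>]) auto
        then show ?thesis using cost[of "p k"] by (simp add: u_def path_cost_def)
      qed
      then show "\<forall>\<^sub>F k in sequentially. (\<integral>\<^sup>+ t. u k t \<partial>lborel) \<le> ennreal c"
        by (auto simp: eventually_sequentially)
    qed simp
    finally show ?thesis .
  qed
  have N_meas: "(\<lambda>z. 1 * indicator ?N z :: ennreal) \<in> borel_measurable (restrict_space borel S)"
    using const_indicator_measurable[OF INT_open_borel[OF U(1)], of 1] by simp
  let ?I = "\<lambda>t. indicator ?N (\<sigma> t) * indicator {0..T'} t :: ennreal"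
  have I_meas: "?I \<in> borel_measurable borel" using path_cost_measurable[OF path N_meas] by simp
  have "of_nat k * (\<integral>\<^sup>+ t. ?I t \<partial>lborel) \<le> ennreal c" for k
  proof -
    have "of_nat k * (\<integral>\<^sup>+ t. ?I t \<partial>lborel) = (\<integral>\<^sup>+ t. of_nat k * ?I t \<partial>lborel)"
      using I_meas by (intro nn_integral_cmult[symmetric]) simp
    also have "\<dots> \<le> path_cost (h k) T' \<sigma>"
      unfolding path_cost_def using h_N by (intro nn_integral_mono) (auto split: split_indicator)
    finally show ?thesis using cost'[of k] by simp
  qed
  then have "(\<integral>\<^sup>+ t. ?I t \<partial>lborel) = 0"
  proof (rule_tac ccontr)
    assume bound: "\<And>k. of_nat k * (\<integral>\<^sup>+ t. ?I t \<partial>lborel) \<le> ennreal c" and "(\<integral>\<^sup>+ t. ?I t \<partial>lborel) \<noteq> 0"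
    moreover have "(SUP k. of_nat k * (\<integral>\<^sup>+ t. ?I t \<partial>lborel)) = (SUP k::nat. of_nat k) * (\<integral>\<^sup>+ t. ?I t \<partial>lborel)"
      by (rule SUP_mult_right_ennreal[symmetric])
    ultimately have "top = (SUP k. of_nat k * (\<integral>\<^sup>+ t. ?I t \<partial>lborel))"
      by (simp only: ennreal_SUP_of_nat_eq_top) (simp add: ennreal_top_mult)
    also have "\<dots> \<le> ennreal c" by (intro SUP_least bound)
    finally show False by (simp add: top_unique)
  qed
  then have "AE t in lborel. ?I t = 0" using I_meas by (subst (asm) nn_integral_0_iff_AE) auto
  then have "AE t in lborel. t \<in> {0..T'} \<longrightarrow> \<sigma> t \<notin> ?N"
    by eventually_elim (auto simp: indicator_def split: if_splits)
  moreover have "T' \<le> (L + 2) * dist x y" using T' by (simp add: c_def)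
  ultimately show thesis using that path by blast
qed

end

section \<open>Doubling measures\<close>

locale doubling =
  fixes S :: "'a::metric_space set" and \<mu> :: "'a measure" and D :: real
  assumes borel: "borel_measure_on S \<mu>" and D_ge_1: "1 \<le> D"
    and ball_pos: "\<And>x r. x \<in> S \<Longrightarrow> 0 < r \<Longrightarrow> 0 < emeasure \<mu> (rel_ball S x r)"
    and ball_finite: "\<And>x r. x \<in> S \<Longrightarrow> 0 < r \<Longrightarrow> emeasure \<mu> (rel_ball S x r) < \<infinity>"
    and doubling: "\<And>x r. x \<in> S \<Longrightarrow> 0 < r \<Longrightarrow>
      emeasure \<mu> (rel_ball S x (2 * r)) \<le> ennreal D * emeasure \<mu> (rel_ball S x r)"
begin

lemma space_eq: "space \<mu> = S" and sets_eq: "sets \<mu> = sets (restrict_space borel S)"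
  using borel by (auto simp: borel_measure_on_def)

lemma ball_sets: "rel_ball S x r \<in> sets \<mu>"
  unfolding sets_eq sets_restrict_space rel_ball_def by (rule image_eqI[of _ _ "ball x r"]) auto

lemma borel_measurable_iff: "g \<in> borel_measurable \<mu> \<longleftrightarrow> g \<in> borel_measurable (restrict_space borel S)"
  using measurable_cong_sets[OF sets_eq refl] by blast

lemma doubling_power:
  assumes "x \<in> S" "0 < r"
  shows "emeasure \<mu> (rel_ball S x (2 ^ n * r)) \<le> ennreal (D ^ n) * emeasure \<mu> (rel_ball S x r)"
proof (induction n)
  case (Suc n)
  have "emeasure \<mu> (rel_ball S x (2 * (2 ^ n * r))) \<le> ennreal D * emeasure \<mu> (rel_ball S x (2 ^ n * r))"
    using assms by (intro doubling) auto
  also have "\<dots> \<le> ennreal D * (ennreal (D ^ n) * emeasure \<mu> (rel_ball S x r))"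
    by (intro mult_left_mono Suc.IH) auto
  finally show ?case using D_ge_1 by (simp add: ennreal_mult mult.assoc)
qed simp

lemma finite_measure_if_bounded:
  assumes "bounded S"
  shows "finite_measure \<mu>"
proof
  show "emeasure \<mu> (space \<mu>) \<noteq> \<infinity>"
  proof (cases "S = {}")
    case False
    then obtain x where x: "x \<in> S" by auto
    obtain R where "0 < R" "S \<subseteq> ball x R" using bounded_subset_ballD[OF assms] by blast
    then have "rel_ball S x R = S" by (auto simp: rel_ball_def)
    then show ?thesis using ball_finite[OF x \<open>0 < R\<close>] space_eq by (auto simp: less_top)
  qed (simp add: space_eq)
qed

text \<open>Disjoint balls of a fixed radius in a bounded space have measures bounded below by a fixed
  fraction of the finite total measure, so there cannot be arbitrarily many of them.\<close>

lemma bounded_imp_totally_bounded: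
  assumes "bounded S" "0 < \<epsilon>"
  shows "\<exists>k. finite k \<and> S \<subseteq> (\<Union>x\<in>k. ball x \<epsilon>)"
proof (rule ccontr)
  assume not: "\<not> ?thesis"
  then obtain x0 where x0: "x0 \<in> S" by (metis empty_subsetI ex_in_conv finite.emptyI)
  interpret finite_measure \<mu> by (rule finite_measure_if_bounded[OF assms(1)])
  obtain R0 where R0: "0 < R0" "S \<subseteq> ball x0 R0" using bounded_subset_ballD[OF assms(1)] by blast
  define R where "R = 2 * R0"
  have "dist x y < R" if "x \<in> S" "y \<in> S" for x y
  proof -
    have "dist x0 x < R0" "dist x0 y < R0" using R0(2) that by auto
    then show ?thesis using dist_triangle3[of x y x0] by (simp add: R_def)
  qed
  then have R: "0 < R" "\<And>x y. x \<in> S \<Longrightarrow> y \<in> S \<Longrightarrow> dist x y < R" using R0 by (auto simp: R_def)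
  have ball_R: "rel_ball S x r = S" if "x \<in> S" "R \<le> r" for x r
    using R(2)[OF that(1)] that by (fastforce simp: rel_ball_def)
  obtain n where n: "R \<le> 2 ^ n * (\<epsilon> / 2)"
  proof -
    obtain n where "R / (\<epsilon> / 2) < 2 ^ n" using real_arch_pow[of 2 "R / (\<epsilon> / 2)"] by auto
    then show thesis using that[of n] assms(2) by (simp add: field_simps)
  qed
  define m where "m = measure \<mu> S"
  have emS: "emeasure \<mu> S = ennreal m" "0 < m"
    using ball_pos[OF x0 R(1)] ball_finite[OF x0 R(1)] ball_R[OF x0, of R]
    by (auto simp: m_def measure_def enn2real_positive_iff less_top)
  have ball_large: "m / D ^ n \<le> measure \<mu> (rel_ball S x (\<epsilon> / 2))" if "x \<in> S" for x
  proof -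
    have fin: "emeasure \<mu> (rel_ball S x (\<epsilon> / 2)) = ennreal (measure \<mu> (rel_ball S x (\<epsilon> / 2)))"
      using ball_finite[OF that, of "\<epsilon> / 2"] assms(2) by (intro emeasure_eq_ennreal_measure) auto
    have "ennreal m \<le> ennreal (D ^ n) * emeasure \<mu> (rel_ball S x (\<epsilon> / 2))"
      using doubling_power[OF that, of "\<epsilon> / 2" n] ball_R[OF that n] emS(1) assms(2) by simp
    then have "m \<le> D ^ n * measure \<mu> (rel_ball S x (\<epsilon> / 2))"
      unfolding fin using D_ge_1 by (simp add: ennreal_mult[symmetric] ennreal_le_iff)
    then show ?thesis using D_ge_1 by (simp add: field_simps)
  qed
  have separated: "\<exists>F. F \<subseteq> S \<and> finite F \<and> card F = k \<and> (\<forall>x\<in>F. \<forall>y\<in>F. x \<noteq> y \<longrightarrow> \<epsilon> \<le> dist x y)" for k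
  proof (induction k)
    case 0
    show ?case by (intro exI[of _ "{}"]) auto
  next
    case (Suc k)
    then obtain F where F: "F \<subseteq> S" "finite F" "card F = k" "\<forall>x\<in>F. \<forall>y\<in>F. x \<noteq> y \<longrightarrow> \<epsilon> \<le> dist x y" by blast
    have "\<not> S \<subseteq> (\<Union>x\<in>F. ball x \<epsilon>)" using not F(2) by blast
    then obtain z where z: "z \<in> S" "\<And>x. x \<in> F \<Longrightarrow> \<epsilon> \<le> dist x z"
      by (force simp: not_less)
    then have "z \<notin> F" using assms(2) by fastforce
    then show ?case using F z by (intro exI[of _ "insert z F"]) (auto simp: dist_commute)
  qed
  obtain k :: nat where k: "D ^ n < real k" using reals_Archimedean2 by blast
  obtain F where F: "F \<subseteq> S" "finite F" "card F = k" "\<forall>x\<in>F. \<forall>y\<in>F. x \<noteq> y \<longrightarrow> \<epsilon> \<le> dist x y"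
    using separated[of k] by (elim exE conjE)
  have disj: "disjoint_family_on (\<lambda>x. rel_ball S x (\<epsilon> / 2)) F"
    unfolding disjoint_family_on_def
  proof (intro ballI impI equals0I)
    fix x y z assume "x \<in> F" "y \<in> F" "x \<noteq> y" "z \<in> rel_ball S x (\<epsilon> / 2) \<inter> rel_ball S y (\<epsilon> / 2)"
    then show False using F(4) dist_triangle2[of x y z] by (fastforce simp: rel_ball_def)
  qed
  have "real k * (m / D ^ n) = (\<Sum>x\<in>F. m / D ^ n)" using F(3) by simp
  also have "\<dots> \<le> (\<Sum>x\<in>F. measure \<mu> (rel_ball S x (\<epsilon> / 2)))"
    using F(1) by (intro sum_mono ball_large) auto
  also have "\<dots> = measure \<mu> (\<Union>x\<in>F. rel_ball S x (\<epsilon> / 2))"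
    using F(2) disj ball_sets by (intro finite_measure_finite_Union[symmetric]) auto
  also have "\<dots> \<le> m"
    using bounded_measure[of "\<Union>x\<in>F. rel_ball S x (\<epsilon> / 2)"] by (simp add: m_def space_eq)
  finally have "real k \<le> D ^ n" using emS(2) D_ge_1 by (simp add: field_simps)
  then show False using k by simp
qed

text \<open>If a continuous function has small mean oscillation on balls, then the constants that it is
  close to on the balls with centre \<^term>\<open>x\<close> and radii decreasing to zero form a sequence with
  geometrically decreasing differences, whose limit is the value at \<^term>\<open>x\<close>.  The constants
  of comparable balls around two points are close to each other, too.\<close>

lemma lipschitz_of_mean_oscillation:
  assumes w: "continuous_on S w" and \<kappa>: "0 \<le> \<kappa>"
    and osc: "\<And>x r. x \<in> S \<Longrightarrow> 0 < r \<Longrightarrow>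
      (\<integral>\<^sup>+ z \<in> rel_ball S x r. ennreal \<bar>w z - m x r\<bar> \<partial>\<mu>) \<le> ennreal (\<kappa> * r) * emeasure \<mu> (rel_ball S x r)"
    and xy: "x \<in> S" "y \<in> S"
  shows "\<bar>w x - w y\<bar> \<le> \<kappa> * (6 * (D + 1) + 2 * (D\<^sup>2 + 1)) * dist x y"
proof (cases "x = y")
  case False
  have w_meas: "w \<in> borel_measurable \<mu>"
    using borel_measurable_continuous_on_restrict[OF w] by (simp add: borel_measurable_iff)
  have osc_meas: "(\<lambda>z. ennreal \<bar>w z - c\<bar> * indicator (rel_ball S x r) z) \<in> borel_measurable \<mu>" for c x r
    using w_meas ball_sets[of x r] by measurable
  have compare: "\<bar>m x r - m y s\<bar> \<le> \<kappa> * (A + 1) * r"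
    if xr: "x \<in> S" "0 < r" and ys: "y \<in> S" "0 < s" "s \<le> r" and sub: "rel_ball S y s \<subseteq> rel_ball S x r"
      and A: "emeasure \<mu> (rel_ball S x r) \<le> ennreal A * emeasure \<mu> (rel_ball S y s)" "0 \<le> A"
    for x r y s A
  proof -
    let ?B = "rel_ball S x r" and ?B' = "rel_ball S y s"
    obtain b where b: "emeasure \<mu> ?B' = ennreal b" "0 < b"
      using ball_pos[OF ys(1,2)] ball_finite[OF ys(1,2)] by (cases "emeasure \<mu> ?B'") auto
    have "ennreal \<bar>m x r - m y s\<bar> * ennreal b = (\<integral>\<^sup>+ z \<in> ?B'. ennreal \<bar>m x r - m y s\<bar> \<partial>\<mu>)"
      using ball_sets[of y s] by (simp add: nn_integral_cmult_indicator b)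
    also have "\<dots> \<le> (\<integral>\<^sup>+ z. ennreal \<bar>w z - m x r\<bar> * indicator ?B z + ennreal \<bar>w z - m y s\<bar> * indicator ?B' z \<partial>\<mu>)"
    proof (intro nn_integral_mono)
      fix z
      have "ennreal \<bar>m x r - m y s\<bar> \<le> ennreal \<bar>w z - m x r\<bar> + ennreal \<bar>w z - m y s\<bar>"
        by (simp add: ennreal_plus[symmetric] ennreal_leI del: ennreal_plus)
      then show "ennreal \<bar>m x r - m y s\<bar> * indicator ?B' z \<le>
          ennreal \<bar>w z - m x r\<bar> * indicator ?B z + ennreal \<bar>w z - m y s\<bar> * indicator ?B' z"
        using sub by (auto split: split_indicator)
    qed
    also have "\<dots> = (\<integral>\<^sup>+ z \<in> ?B. ennreal \<bar>w z - m x r\<bar> \<partial>\<mu>) + (\<integral>\<^sup>+ z \<in> ?B'. ennreal \<bar>w z - m y s\<bar> \<partial>\<mu>)"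
      by (intro nn_integral_add osc_meas)
    also have "\<dots> \<le> ennreal (\<kappa> * r) * (ennreal A * ennreal b) + ennreal (\<kappa> * s) * ennreal b"
      using osc[OF xr] osc[OF ys(1,2)] mult_left_mono[OF A(1), of "ennreal (\<kappa> * r)"]
      by (intro add_mono) (auto simp: b intro: order_trans)
    also have "\<dots> = ennreal ((\<kappa> * r * A + \<kappa> * s) * b)"
    proof -
      have "ennreal p * (ennreal A * ennreal b) + ennreal q * ennreal b = ennreal ((p * A + q) * b)"
        if "0 \<le> p" "0 \<le> q" for p q
      proof -
        have "ennreal p * (ennreal A * ennreal b) + ennreal q * ennreal b = ennreal (p * (A * b)) + ennreal (q * b)"
          using that A(2) b(2) by (simp add: ennreal_mult)
        also have "\<dots> = ennreal (p * (A * b) + q * b)"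
          using that A(2) b(2) by (intro ennreal_plus[symmetric]) auto
        finally show ?thesis by (simp add: distrib_right mult.assoc)
      qed
      from this[of "\<kappa> * r" "\<kappa> * s"] show ?thesis using \<kappa> xr ys by simp
    qed
    finally have "\<bar>m x r - m y s\<bar> * b \<le> (\<kappa> * r * A + \<kappa> * s) * b"
      using \<kappa> xr ys A(2) b(2) by (subst (asm) ennreal_mult[symmetric]) (auto simp: ennreal_le_iff)
    then have "\<bar>m x r - m y s\<bar> \<le> \<kappa> * r * A + \<kappa> * s" using b(2) by simp
    also have "\<dots> \<le> \<kappa> * r * A + \<kappa> * r" using \<kappa> ys(3) by (intro add_left_mono mult_left_mono) auto
    finally show ?thesis by (simp add: algebra_simps)
  qed
  \<comment> \<open>The slack \<^term>\<open>r\<close> makes the contradiction strict.\<close>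
  have near: "\<exists>z\<in>rel_ball S x r. \<bar>w z - m x r\<bar> \<le> (\<kappa> + 1) * r" if xr: "x \<in> S" "0 < r" for x r
  proof (rule ccontr)
    assume far: "\<not> ?thesis"
    let ?B = "rel_ball S x r"
    obtain b where b: "emeasure \<mu> ?B = ennreal b" "0 < b"
      using ball_pos[OF xr] ball_finite[OF xr] by (cases "emeasure \<mu> ?B") auto
    have "ennreal ((\<kappa> + 1) * r) * ennreal b = (\<integral>\<^sup>+ z \<in> ?B. ennreal ((\<kappa> + 1) * r) \<partial>\<mu>)"
      using ball_sets[of x r] by (simp add: nn_integral_cmult_indicator b)
    also have "\<dots> \<le> (\<integral>\<^sup>+ z \<in> ?B. ennreal \<bar>w z - m x r\<bar> \<partial>\<mu>)"
      using far by (intro nn_integral_mono) (auto simp: not_le ennreal_leI less_imp_le split: split_indicator)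
    also have "\<dots> \<le> ennreal (\<kappa> * r) * ennreal b" using osc[OF xr] b by simp
    finally have "(\<kappa> + 1) * r * b \<le> \<kappa> * r * b"
      using \<kappa> xr b by (simp add: ennreal_mult[symmetric] ennreal_le_iff del: mult_le_cancel_right)
    then show False using mult_pos_pos[OF b(2) xr(2)] by (simp add: algebra_simps)
  qed
  have to_value: "\<bar>m x r - w x\<bar> \<le> 2 * \<kappa> * (D + 1) * r" if xr: "x \<in> S" "0 < r" for x r
  proof -
    define s where "s k = r / 2 ^ k" for k :: nat
    have s: "0 < s k" "s (Suc k) = s k / 2" for k using xr by (auto simp: s_def)
    have step: "\<bar>m x (s k) - m x (s (Suc k))\<bar> \<le> \<kappa> * (D + 1) * s k" for k
    proof (rule compare[OF xr(1) s(1) xr(1) s(1)])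
      show "s (Suc k) \<le> s k" "rel_ball S x (s (Suc k)) \<subseteq> rel_ball S x (s k)"
        using s[of k] by (auto simp: rel_ball_def)
      have "2 * s (Suc k) = s k" by (simp add: s(2))
      then show "emeasure \<mu> (rel_ball S x (s k)) \<le> ennreal D * emeasure \<mu> (rel_ball S x (s (Suc k)))"
        using doubling[OF xr(1) s(1)[of "Suc k"]] by (simp only:)
      show "0 \<le> D" using D_ge_1 by simp
    qed
    have tele: "\<bar>m x r - m x (s k)\<bar> \<le> 2 * \<kappa> * (D + 1) * (r - s k)" for k
    proof (induction k)
      case (Suc k)
      have "2 * \<kappa> * (D + 1) * (r - s k) + \<kappa> * (D + 1) * s k = 2 * \<kappa> * (D + 1) * (r - s (Suc k))"
        unfolding s(2) by (simp add: algebra_simps)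
      then show ?case using Suc step[of k] by linarith
    qed (simp add: s_def)
    have s_lim: "s \<longlonglongrightarrow> 0"
      unfolding s_def using LIMSEQ_divide_realpow_zero[of 2 r] by simp
    obtain z where z: "\<And>k. z k \<in> rel_ball S x (s k)" "\<And>k. \<bar>w (z k) - m x (s k)\<bar> \<le> (\<kappa> + 1) * s k"
      using near[OF xr(1) s(1)] by metis
    have "(\<lambda>k. dist (z k) x) \<longlonglongrightarrow> 0"
      by (rule tendsto_sandwich[OF _ _ tendsto_const s_lim])
         (use z(1) in \<open>auto simp: rel_ball_def dist_commute less_imp_le\<close>)
    then have "z \<longlonglongrightarrow> x" by (simp add: tendsto_dist_iff[symmetric])
    then have "(\<lambda>k. w (z k)) \<longlonglongrightarrow> w x"
      using z(1) by (intro continuous_on_tendsto_compose[OF w _ xr(1)]) (auto simp: rel_ball_def)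
    then have "(\<lambda>k. \<bar>m x r - w (z k)\<bar>) \<longlonglongrightarrow> \<bar>m x r - w x\<bar>" by (intro tendsto_intros)
    moreover have "(\<lambda>k. 2 * \<kappa> * (D + 1) * (r - s k) + (\<kappa> + 1) * s k) \<longlonglongrightarrow> 2 * \<kappa> * (D + 1) * (r - 0) + (\<kappa> + 1) * 0"
      by (intro tendsto_intros s_lim)
    moreover have "\<bar>m x r - w (z k)\<bar> \<le> 2 * \<kappa> * (D + 1) * (r - s k) + (\<kappa> + 1) * s k" for k
      using tele[of k] z(2)[of k] by linarith
    ultimately have "\<bar>m x r - w x\<bar> \<le> 2 * \<kappa> * (D + 1) * (r - 0) + (\<kappa> + 1) * 0" by (intro LIMSEQ_le) auto
    then show ?thesis by simp
  qed
  define r where "r = dist x y"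
  have r: "0 < r" using False by (simp add: r_def)
  \<comment> \<open>The ball around \<^term>\<open>x\<close> is comparable to a ball around \<^term>\<open>y\<close> with half its radius, because
    doubling the latter twice covers it.\<close>
  have sub: "rel_ball S y r \<subseteq> rel_ball S x (2 * r)" "rel_ball S x (2 * r) \<subseteq> rel_ball S y (2\<^sup>2 * r)"
  proof -
    have "dist x z < 2 * r" if "dist y z < r" for z using that dist_triangle[of x z y] by (simp add: r_def)
    moreover have "dist y z < 4 * r" if "dist x z < 2 * r" for z
      using that dist_triangle[of y z x] r unfolding r_def dist_commute[of y x] by linarith
    ultimately show "rel_ball S y r \<subseteq> rel_ball S x (2 * r)" "rel_ball S x (2 * r) \<subseteq> rel_ball S y (2\<^sup>2 * r)"
      by (auto simp: rel_ball_def)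
  qed
  have "emeasure \<mu> (rel_ball S x (2 * r)) \<le> ennreal (D\<^sup>2) * emeasure \<mu> (rel_ball S y r)"
    using emeasure_mono[OF sub(2) ball_sets] doubling_power[OF xy(2) r, of 2] by (rule order_trans)
  then have "\<bar>m x (2 * r) - m y r\<bar> \<le> \<kappa> * (D\<^sup>2 + 1) * (2 * r)"
    using r xy sub(1) by (intro compare) auto
  moreover have "\<bar>m x (2 * r) - w x\<bar> \<le> 2 * \<kappa> * (D + 1) * (2 * r)" using r by (intro to_value xy) auto
  moreover have "\<bar>m y r - w y\<bar> \<le> 2 * \<kappa> * (D + 1) * r" using r by (intro to_value xy) auto
  ultimately have "\<bar>w x - w y\<bar> \<le>
      2 * \<kappa> * (D + 1) * (2 * r) + \<kappa> * (D\<^sup>2 + 1) * (2 * r) + 2 * \<kappa> * (D + 1) * r" by linarith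
  also have "\<dots> = \<kappa> * (6 * (D + 1) + 2 * (D\<^sup>2 + 1)) * r" by (simp add: algebra_simps)
  finally show ?thesis by (simp add: r_def)
qed simp

lemma diameter_rel_ball_le:
  assumes "x \<in> S" "0 < r"
  shows "diameter (rel_ball S x r) \<le> 2 * r"
proof -
  have "dist y z \<le> 2 * r" if "y \<in> rel_ball S x r" "z \<in> rel_ball S x r" for y z
    using that dist_triangle3[of y z x] by (simp add: rel_ball_def)
  moreover have "x \<in> rel_ball S x r" using assms by (simp add: rel_ball_def)
  ultimately have "(SUP (y, z) \<in> rel_ball S x r \<times> rel_ball S x r. dist y z) \<le> 2 * r"
    by (intro cSUP_least) auto
  then show ?thesis using \<open>x \<in> rel_ball S x r\<close> by (auto simp: diameter_def)
qed

lemma infinity_poincare_imp_lipschitz: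
  assumes "infinity_poincare S \<mu>"
  obtains L where "1 \<le> L"
    "\<And>w \<rho> K x y. continuous_on S w \<Longrightarrow> upper_gradient S \<rho> w \<Longrightarrow> 0 \<le> K \<Longrightarrow>
      AE z in \<mu>. \<rho> z \<le> ennreal K \<Longrightarrow> x \<in> S \<Longrightarrow> y \<in> S \<Longrightarrow> \<bar>w x - w y\<bar> \<le> L * K * dist x y"
proof -
  obtain C \<Lambda> :: real where C: "0 < C" and "\<forall>w \<rho> x r.
      w \<in> borel_measurable (completion \<mu>) \<and> upper_gradient S \<rho> w \<and> x \<in> S \<and> 0 < r \<longrightarrow>
        (\<integral>\<^sup>+ z \<in> rel_ball S x r. ennreal \<bar>w z - mean_on (completion \<mu>) (rel_ball S x r) w\<bar>
           \<partial>completion \<mu>) / emeasure \<mu> (rel_ball S x r)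
        \<le> ennreal C * ennreal (diameter (rel_ball S x r)) *
            esssup (restrict_space \<mu> (rel_ball S x (\<Lambda> * r))) \<rho>"
    using assms unfolding infinity_poincare_def by (elim exE conjE)
  note poincare = this(2)[rule_format, OF conjI[OF _ conjI[OF _ conjI]]]
  define E where "E = 6 * (D + 1) + 2 * (D\<^sup>2 + 1)"
  have E: "0 \<le> E" using D_ge_1 by (simp add: E_def)
  show thesis
  proof (rule that[of "max 1 (2 * C * E)"])
    fix w \<rho> and K :: real and x y
    assume w: "continuous_on S w" and \<rho>: "upper_gradient S \<rho> w" and K: "0 \<le> K" "AE z in \<mu>. \<rho> z \<le> ennreal K"
      and xy: "x \<in> S" "y \<in> S"
    have w_meas: "w \<in> borel_measurable (completion \<mu>)"
      using borel_measurable_continuous_on_restrict[OF w] by (simp add: borel_measurable_iff measurable_completion)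
    have \<rho>_meas: "\<rho> \<in> borel_measurable \<mu>" using \<rho> by (simp add: upper_gradient_def borel_measurable_iff)
    define m where "m x r = mean_on (completion \<mu>) (rel_ball S x r) w" for x r
    have osc: "(\<integral>\<^sup>+ z \<in> rel_ball S x r. ennreal \<bar>w z - m x r\<bar> \<partial>\<mu>)
        \<le> ennreal (2 * C * K * r) * emeasure \<mu> (rel_ball S x r)" if xr: "x \<in> S" "0 < r" for x r
    proof -
      let ?B = "rel_ball S x r"
      let ?I = "\<integral>\<^sup>+ z \<in> ?B. ennreal \<bar>w z - m x r\<bar> \<partial>\<mu>"
      have "esssup (restrict_space \<mu> (rel_ball S x (\<Lambda> * r))) \<rho> \<le> ennreal K"
      proof (rule esssup_I)
        show "\<rho> \<in> borel_measurable (restrict_space \<mu> (rel_ball S x (\<Lambda> * r)))"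
          by (rule measurable_restrict_space1[OF \<rho>_meas])
        show "AE z in restrict_space \<mu> (rel_ball S x (\<Lambda> * r)). \<rho> z \<le> ennreal K"
          using K(2) ball_sets by (subst AE_restrict_space_iff) (auto elim!: eventually_mono)
      qed
      then have "?I / emeasure \<mu> ?B \<le> ennreal C * ennreal (2 * r) * ennreal K"
      proof -
        assume "esssup (restrict_space \<mu> (rel_ball S x (\<Lambda> * r))) \<rho> \<le> ennreal K"
        then have "ennreal C * ennreal (diameter ?B) * esssup (restrict_space \<mu> (rel_ball S x (\<Lambda> * r))) \<rho>
            \<le> ennreal C * ennreal (2 * r) * ennreal K"
          using diameter_rel_ball_le[OF xr] by (intro mult_mono ennreal_leI order_refl) auto
        with poincare[OF w_meas \<rho> xr] show ?thesis
          unfolding m_def nn_integral_completion by (rule order_trans)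
      qed
      then have "?I / emeasure \<mu> ?B * emeasure \<mu> ?B \<le> ennreal C * ennreal (2 * r) * ennreal K * emeasure \<mu> ?B"
        by (rule mult_right_mono) simp
      moreover have "?I / emeasure \<mu> ?B * emeasure \<mu> ?B = ?I"
        using ball_pos[OF xr] ball_finite[OF xr] by (simp add: ennreal_divide_times)
      moreover have "ennreal C * ennreal (2 * r) * ennreal K = ennreal (2 * C * K * r)"
      proof -
        have "ennreal C * ennreal (2 * r) * ennreal K = ennreal (C * (2 * r) * K)"
          using ennreal_mult[of C "2 * r"] ennreal_mult[of "C * (2 * r)" K] C K xr by simp
        also have "C * (2 * r) * K = 2 * C * K * r" by simp
        finally show ?thesis .
      qed
      ultimately show "?I \<le> ennreal (2 * C * K * r) * emeasure \<mu> ?B" by simp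
    qed
    have "\<bar>w x - w y\<bar> \<le> (2 * C * K) * E * dist x y"
      unfolding E_def using C K by (intro lipschitz_of_mean_oscillation[OF w _ osc xy]) auto
    also have "\<dots> = 2 * C * E * K * dist x y" by simp
    also have "\<dots> \<le> max 1 (2 * C * E) * K * dist x y"
      using K(1) by (intro mult_right_mono) auto
    finally show "\<bar>w x - w y\<bar> \<le> max 1 (2 * C * E) * K * dist x y" .
  qed simp
qed

end

section \<open>Regularity of finite Borel measures on metric spaces\<close>

text \<open>The sets that can be approximated from inside by closed sets and from outside by open sets form
  a sigma-algebra.  An open set is the union of the closed sets of points whose distance to its
  complement is at least a given positive number.\<close>

lemma finite_borel_measure_regular:
  fixes \<nu> :: "'a::metric_space measure"
  assumes "finite_measure \<nu>" and sets: "sets \<nu> = sets borel" and "B \<in> sets borel" "0 < \<epsilon>"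
  obtains C V where "closed C" "open V" "C \<subseteq> B" "B \<subseteq> V" "measure \<nu> (V - C) < \<epsilon>"
proof -
  interpret finite_measure \<nu> by fact
  have closed_sets: "closed C \<Longrightarrow> C \<in> sets \<nu>" and open_sets: "open V \<Longrightarrow> V \<in> sets \<nu>" for C V
    by (auto simp: sets)
  have "B \<in> sigma_sets UNIV {U. open U}" using assms(3) by (simp add: borel_def)
  then have "\<forall>\<epsilon>>0. \<exists>C V. closed C \<and> open V \<and> C \<subseteq> B \<and> B \<subseteq> V \<and> measure \<nu> (V - C) < \<epsilon>"
  proof (induction B rule: sigma_sets.induct)
    case (Basic V)
    show ?case
    proof (intro allI impI)
      fix \<epsilon> :: real assume "0 < \<epsilon>"
      \<comment> \<open>The distance to the empty set is zero by convention, so this case is separate.\<close>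
      define C where "C n = (if - V = {} then V else {z. 1 / real (Suc n) \<le> infdist z (- V)})" for n
      have C: "closed (C n)" "C n \<subseteq> V" for n
      proof -
        have "z \<in> V" if "1 / real (Suc n) \<le> infdist z (- V)" for z
          using that by (cases "z \<in> V") (auto simp: field_simps)
        then show "C n \<subseteq> V" by (auto simp: C_def)
        have "closed {z. 1 / real (Suc n) \<le> infdist z (- V)}"
          by (intro closed_Collect_le continuous_intros)
        moreover have "closed V" if "- V = {}" using that by (metis Compl_empty_eq closed_UNIV double_complement)
        ultimately show "closed (C n)" by (simp add: C_def)
      qed
      have Un: "(\<Union>n. C n) = V"
      proof (cases "- V = {}")
        case False
        have "\<exists>n. z \<in> C n" if "z \<in> V" for z
        proof -
          have "closed (- V)" using Basic by auto
          then have "0 < infdist z (- V)"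
            using in_closed_iff_infdist_zero[OF _ False, of z] that infdist_nonneg[of z "- V"]
            by (auto simp: less_le)
          then obtain n where "1 / real (Suc n) < infdist z (- V)" using nat_approx_posE by blast
          then show ?thesis using False by (auto simp: C_def intro!: exI[of _ n])
        qed
        then show ?thesis using C(2) by blast
      qed (auto simp: C_def)
      have "(\<lambda>n. measure \<nu> (V - C n)) \<longlonglongrightarrow> measure \<nu> (\<Inter>n. V - C n)"
      proof (rule finite_Lim_measure_decseq)
        show "range (\<lambda>n. V - C n) \<subseteq> sets \<nu>"
          using C(1) Basic open_sets closed_sets by auto
        have "1 / real (Suc n) \<le> 1 / real (Suc m)" if "m \<le> n" for m n
          using that by (intro divide_left_mono) auto
        then have "C m \<subseteq> C n" if "m \<le> n" for m n
          using that unfolding C_def by (auto intro: order_trans)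
        then show "decseq (\<lambda>n. V - C n)" by (auto simp: decseq_def)
      qed
      also have "(\<Inter>n. V - C n) = {}" using Un by auto
      finally have "(\<lambda>n. measure \<nu> (V - C n)) \<longlonglongrightarrow> 0" by simp
      from order_tendstoD(2)[OF this \<open>0 < \<epsilon>\<close>] obtain n where "measure \<nu> (V - C n) < \<epsilon>"
        by (auto simp: eventually_sequentially)
      then show "\<exists>C V'. closed C \<and> open V' \<and> C \<subseteq> V \<and> V \<subseteq> V' \<and> measure \<nu> (V' - C) < \<epsilon>"
        using C Basic by (intro exI[of _ "C n"] exI[of _ V]) auto
    qed
  next
    case Empty
    show ?case by (intro allI impI exI[of _ "{}"]) auto
  next
    case (Compl B)
    show ?case
    proof (intro allI impI)
      fix \<epsilon> :: real assume "0 < \<epsilon>"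
      from Compl.IH[rule_format, OF this]
      obtain C V where CV: "closed C" "open V" "C \<subseteq> B" "B \<subseteq> V" "measure \<nu> (V - C) < \<epsilon>"
        by (elim exE conjE)
      have "- C - - V = V - C" by auto
      then show "\<exists>C V. closed C \<and> open V \<and> C \<subseteq> UNIV - B \<and> UNIV - B \<subseteq> V \<and> measure \<nu> (V - C) < \<epsilon>"
        using CV by (intro exI[of _ "- V"] exI[of _ "- C"]) auto
    qed
  next
    case (Union B)
    show ?case
    proof (intro allI impI)
      fix \<epsilon> :: real assume "0 < \<epsilon>"
      define e where "e i = \<epsilon> / 2 * (1/2) ^ Suc i" for i :: nat
      have "\<exists>CV. closed (fst CV) \<and> open (snd CV) \<and> fst CV \<subseteq> B i \<and> B i \<subseteq> snd CV \<and>
          measure \<nu> (snd CV - fst CV) < e i" for i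
      proof -
        have "0 < e i" using \<open>0 < \<epsilon>\<close> by (simp add: e_def)
        from Union.IH[rule_format, OF this, of i]
        obtain C V where "closed C" "open V" "C \<subseteq> B i" "B i \<subseteq> V" "measure \<nu> (V - C) < e i"
          by (elim exE conjE)
        then show ?thesis by (intro exI[of _ "(C, V)"]) simp
      qed
      then have "\<forall>i. \<exists>CV. closed (fst CV) \<and> open (snd CV) \<and> fst CV \<subseteq> B i \<and> B i \<subseteq> snd CV \<and>
          measure \<nu> (snd CV - fst CV) < e i" by (rule allI)
      from choice[OF this] obtain CV where
        CV: "closed (fst (CV i))" "open (snd (CV i))" "fst (CV i) \<subseteq> B i" "B i \<subseteq> snd (CV i)"
          "measure \<nu> (snd (CV i) - fst (CV i)) < e i" for i by blast
      define C V where "C i = fst (CV i)" and "V i = snd (CV i)" for i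
      have C: "closed (C i)" "C i \<subseteq> B i" and V: "open (V i)" "B i \<subseteq> V i"
        and less: "measure \<nu> (V i - C i) < e i" for i
        using CV[of i] by (auto simp: C_def V_def)
      let ?V = "\<Union>i. V i"
      have sums: "e sums (\<epsilon> / 2)"
        unfolding e_def using sums_mult[OF power_half_series, of "\<epsilon> / 2"] by simp
      have CV_sets: "V i - C i \<in> sets \<nu>" "?V \<in> sets \<nu>" "(\<Union>i\<in>I. C i) \<in> sets \<nu>" for i and I :: "nat set"
        using C(1) V(1) open_sets closed_sets by (auto intro!: sets.countable_UN')
      have summable: "summable (\<lambda>i. measure \<nu> (V i - C i))"
        using sums_summable[OF sums] by (rule summable_comparison_test[rotated])
          (use less in \<open>auto simp: less_imp_le\<close>)
      have "measure \<nu> (?V - (\<Union>i. C i)) \<le> measure \<nu> (\<Union>i. V i - C i)"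
        using CV_sets by (intro finite_measure_mono sets.countable_UN) auto
      also have "\<dots> \<le> (\<Sum>i. measure \<nu> (V i - C i))"
        using CV_sets summable by (intro finite_measure_subadditive_countably) auto
      also have "\<dots> \<le> \<epsilon> / 2"
        unfolding sums_unique[OF sums] using less summable sums_summable[OF sums]
        by (intro suminf_le) (auto simp: less_imp_le)
      finally have "measure \<nu> (?V - (\<Union>i. C i)) < \<epsilon>" using \<open>0 < \<epsilon>\<close> by simp
      moreover have "(\<lambda>n. measure \<nu> (?V - (\<Union>i\<in>{..<n}. C i))) \<longlonglongrightarrow> measure \<nu> (\<Inter>n. ?V - (\<Union>i\<in>{..<n}. C i))"
      proof (rule finite_Lim_measure_decseq)
        show "range (\<lambda>n. ?V - (\<Union>i\<in>{..<n}. C i)) \<subseteq> sets \<nu>" using CV_sets by auto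
        show "decseq (\<lambda>n. ?V - (\<Union>i\<in>{..<n}. C i))" by (force simp: decseq_def)
      qed
      moreover have "(\<Inter>n. ?V - (\<Union>i\<in>{..<n}. C i)) = ?V - (\<Union>i. C i)" by blast
      ultimately have "\<forall>\<^sub>F n in sequentially. measure \<nu> (?V - (\<Union>i\<in>{..<n}. C i)) < \<epsilon>"
        by (intro order_tendstoD(2)) auto
      then obtain n where "measure \<nu> (?V - (\<Union>i\<in>{..<n}. C i)) < \<epsilon>"
        by (auto simp: eventually_sequentially)
      moreover have "closed (\<Union>i\<in>{..<n}. C i)" using C(1) by (intro closed_UN) auto
      moreover have "open ?V" using V(1) by blast
      moreover have "(\<Union>i\<in>{..<n}. C i) \<subseteq> (\<Union>i. B i)" "(\<Union>i. B i) \<subseteq> ?V" using C(2) V(2) by blast+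
      ultimately show "\<exists>C V. closed C \<and> open V \<and> C \<subseteq> (\<Union>i. B i) \<and> (\<Union>i. B i) \<subseteq> V \<and> measure \<nu> (V - C) < \<epsilon>"
        by (intro exI[of _ "\<Union>i\<in>{..<n}. C i"] exI[of _ ?V] conjI)
    qed
  qed
  then obtain C V where "closed C" "open V" "C \<subseteq> B" "B \<subseteq> V" "measure \<nu> (V - C) < \<epsilon>"
    using \<open>0 < \<epsilon>\<close> by (elim allE impE exE conjE)
  then show thesis by (rule that)
qed

lemma null_set_subset_null_gdelta:
  fixes \<nu> :: "'a::metric_space measure"
  assumes "finite_measure \<nu>" and sets: "sets \<nu> = sets borel" and N: "N \<in> null_sets \<nu>"
  obtains U :: "nat \<Rightarrow> 'a set" where "\<And>i. open (U i)" "decseq U" "N \<subseteq> (\<Inter>i. U i)" "(\<Inter>i. U i) \<in> null_sets \<nu>"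
proof -
  interpret finite_measure \<nu> by fact
  have "\<exists>V. open V \<and> N \<subseteq> V \<and> measure \<nu> V < 1 / real (Suc n)" for n
  proof -
    obtain C V where CV: "closed C" "open V" "C \<subseteq> N" "N \<subseteq> V" "measure \<nu> (V - C) < 1 / real (Suc n)"
    proof (rule finite_borel_measure_regular[OF assms(1,2)])
      show "N \<in> sets borel" using null_setsD2[OF N] sets by simp
    qed auto
    have C: "C \<in> null_sets \<nu>"
      using N CV(1,3) sets by (auto intro: null_sets_subset)
    have "measure \<nu> (V - C) = measure \<nu> V"
      using C CV(2) sets by (intro measure_Diff_null_set) auto
    then show ?thesis using CV by auto
  qed
  then obtain V where V: "\<And>n. open (V n)" "\<And>n. N \<subseteq> V n" "\<And>n. measure \<nu> (V n) < 1 / real (Suc n)"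
    by metis
  define U where "U n = (\<Inter>i\<in>{..n}. V i)" for n
  have U: "open (U n)" for n unfolding U_def using V(1) by (intro open_INT) auto
  have meas: "(\<Inter>i. U i) \<in> sets \<nu>" using U sets by (simp add: INT_open_borel)
  have le: "measure \<nu> (\<Inter>i. U i) \<le> 1 / real (Suc n)" for n
  proof -
    have "measure \<nu> (\<Inter>i. U i) \<le> measure \<nu> (V n)"
      using V(1) sets by (intro finite_measure_mono) (auto simp: U_def)
    then show ?thesis using V(3)[of n] by simp
  qed
  have "measure \<nu> (\<Inter>i. U i) \<le> 0"
    by (rule LIMSEQ_le_const[OF LIMSEQ_Suc[OF lim_1_over_n]]) (use le in auto)
  then have "measure \<nu> (\<Inter>i. U i) = 0" by (rule antisym[OF _ measure_nonneg])
  then have "(\<Inter>i. U i) \<in> null_sets \<nu>"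
    using meas by (auto simp: null_sets_def emeasure_eq_measure)
  moreover have "decseq U" unfolding decseq_def U_def by auto
  moreover have "N \<subseteq> (\<Inter>i. U i)" using V(2) by (auto simp: U_def)
  ultimately show thesis using that U by blast
qed

section \<open>Quasiconvex curves with a bounded line integral\<close>

text \<open>The length function of a 1-Lipschitz curve is 1-Lipschitz and hence maps null sets to null sets.
  So the arc-length parametrization of a curve that spends no time in a set does not do so either.\<close>

lemma arclength_curve_of_lip_path:
  assumes path: "lip_path S x y T \<sigma>" and avoid: "AE t in lborel. t \<in> {0..T} \<longrightarrow> \<sigma> t \<notin> N"
    and f: "\<And>z. z \<in> S \<Longrightarrow> z \<notin> N \<Longrightarrow> f z \<le> M" and "0 \<le> M" and T: "T \<le> C * dist x y"
  obtains c where "c \<in> quasiconvex_curves S C x y" "c \<in> Gamma_f S f x y"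
    "line_integral c (\<lambda>z. ennreal (f z)) \<le> ennreal M * ennreal (C * dist x y)"
proof -
  have T0: "0 \<le> T" and lip: "1-lipschitz_on {0..T} \<sigma>" and img: "\<sigma> ` {0..T} \<subseteq> S" and ends: "\<sigma> 0 = x" "\<sigma> T = y"
    using path by (auto simp: lip_path_def)
  have length_le: "curve_length (0, T, \<sigma>) \<le> ennreal T" using curve_length_lipschitz[OF lip T0] by simp
  interpret rectifiable_curve 0 T \<sigma>
    using T0 lipschitz_on_continuous_on[OF lip] order.strict_trans1[OF length_le ennreal_less_top]
    by unfold_locales auto
  let ?\<tau> = "arclength_reparam (0, T, \<sigma>)"
  let ?c = "(0, len T, ?\<tau>)"
  have len_diff: "len t - len s \<le> t - s" if "0 \<le> s" "s \<le> t" "t \<le> T" for s t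
  proof -
    have "ennreal (len t - len s) \<le> ennreal (t - s)"
      using curve_length_eq_len_diff[OF that] curve_length_lipschitz[of s t \<sigma>] that
        lipschitz_on_subset[OF lip, of "{s..t}"] by auto
    then show ?thesis using that by (simp add: ennreal_le_iff)
  qed
  have len0: "0 \<le> len T" "len T \<le> T" using len_mono[of 0 T] len_diff[of 0 T] T0 by auto
  have curve: "is_curve_in S ?c" "joins ?c x y"
    using reparam_lipschitz reparam_image img reparam_start reparam_end ends len0
    by (auto simp: is_curve_in_def joins_def intro: lipschitz_on_continuous_on)
  have length: "curve_length ?c = ennreal (len T)" using curve_length_reparam[of 0 "len T"] len0 by simp
  have length_C: "ennreal (len T) \<le> ennreal (C * dist x y)" using len0 T by (intro ennreal_leI) simp
  obtain E where E: "{t \<in> {0..T}. \<sigma> t \<in> N} \<subseteq> E" "E \<in> null_sets lborel"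
  proof (rule AE_E[OF avoid])
    fix E assume "{t \<in> space lborel. \<not> (t \<in> {0..T} \<longrightarrow> \<sigma> t \<notin> N)} \<subseteq> E" "emeasure lborel E = 0" "E \<in> sets lborel"
    then show thesis by (intro that[of E]) auto
  qed
  let ?E = "E \<inter> {0..T}"
  have "negligible E" unfolding negligible_iff_null_sets by (rule null_sets_completionI[OF E(2)])
  then have "negligible ?E" by (rule negligible_subset) auto
  then have "negligible (len ` ?E)"
  proof (rule negligible_locally_Lipschitz_image[OF order_refl])
    fix s assume "s \<in> ?E"
    have "norm (len t - len s) \<le> 1 * norm (t - s)" if "t \<in> ?E" for t
      using len_diff[of s t] len_diff[of t s] len_mono[of s t] len_mono[of t s] that \<open>s \<in> ?E\<close>
      by (cases "s \<le> t") auto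
    then show "\<exists>U B. open U \<and> s \<in> U \<and> (\<forall>t\<in>?E \<inter> U. norm (len t - len s) \<le> B * norm (t - s))"
      by (intro exI[of _ UNIV] exI[of _ 1]) auto
  qed
  then have "AE s in lebesgue. s \<notin> len ` ?E"
    by (intro AE_not_in) (simp add: negligible_iff_null_sets)
  then have "AE s in lborel. s \<notin> len ` ?E" by (simp add: AE_completion_iff)
  then have "AE s in lborel. s \<in> {0..len T} \<longrightarrow> f (?\<tau> s) \<le> M"
  proof eventually_elim
    case (elim s)
    show ?case
    proof
      assume "s \<in> {0..len T}"
      then obtain t where t: "t \<in> {0..T}" "s = len t" unfolding len_onto[symmetric] by auto
      then have "\<sigma> t \<notin> N" using elim E(1) by auto
      then show "f (?\<tau> s) \<le> M" using f[of "\<sigma> t"] img t by (auto simp: reparam_len image_subset_iff)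
    qed
  qed
  then have "line_integral ?c (\<lambda>z. ennreal (f z)) \<le> (\<integral>\<^sup>+ s. ennreal M * indicator {0..len T} s \<partial>lborel)"
    unfolding line_integral_arclength_parametrized[OF arclength_parametrized_reparam len0(1)]
    by (intro nn_integral_mono_AE) (auto elim!: eventually_mono intro: ennreal_leI split: split_indicator)
  also have "\<dots> = ennreal M * ennreal (len T)" using len0 by (simp add: nn_integral_cmult_indicator)
  also have "\<dots> \<le> ennreal M * ennreal (C * dist x y)" using length_C by (intro mult_left_mono) auto
  finally have int: "line_integral ?c (\<lambda>z. ennreal (f z)) \<le> ennreal M * ennreal (C * dist x y)" .
  have "ennreal M * ennreal (C * dist x y) < top" by (auto simp: ennreal_mult_less_top)
  with int have "line_integral ?c (\<lambda>z. ennreal (f z)) < \<infinity>" by (auto intro: order.strict_trans1)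
  then have "?c \<in> Gamma_f S f x y"
    using curve length arclength_parametrized_reparam by (auto simp: Gamma_f_def rectifiable_in_def)
  moreover have "?c \<in> quasiconvex_curves S C x y"
    using curve length length_C by (auto simp: quasiconvex_curves_def)
  ultimately show thesis using int that by blast
qed

lemma constant_curve_in_Gamma_f:
  assumes "x \<in> S"
  shows "(0, 0, \<lambda>_. x) \<in> Gamma_f S f x x" "line_integral (0, 0, \<lambda>_. x) \<rho> = 0"
proof -
  have arc: "arclength_parametrized (0, 0, \<lambda>_. x)"
    unfolding arclength_parametrized_def prod.case
  proof (intro conjI allI impI refl)
    fix s t :: real assume "0 \<le> s \<and> s \<le> t \<and> t \<le> 0"
    then have "s = 0" "t = 0" by auto
    then show "curve_length (s, t, \<lambda>_. x) = ennreal (t - s)" by simp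
  qed
  have int: "line_integral (0, 0, \<lambda>_. x) \<rho> = 0" for \<rho>
    unfolding line_integral_arclength_parametrized[OF arc order_refl]
    by (subst nn_integral_0_iff_AE) (auto intro!: AE_I[of _ _ "{0}"] simp: indicator_def)
  then show "line_integral (0, 0, \<lambda>_. x) \<rho> = 0" .
  show "(0, 0, \<lambda>_. x) \<in> Gamma_f S f x x"
    using arc int assms by (auto simp: Gamma_f_def rectifiable_in_def is_curve_in_def joins_def)
qed

lemma L_f_le: "c \<in> Gamma_f S f x y \<Longrightarrow> L_f S f x y \<le> line_integral c (\<lambda>z. ennreal (f z))"
  unfolding L_f_def by (rule INF_lower)

theorem proposition5p6:
  fixes \<Omega> :: "'a::metric_space set" and \<mu> :: "'a measure" and f :: "'a \<Rightarrow> real"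
  assumes "complete (UNIV :: 'a set)" and "length_space (UNIV :: 'a set)"
    and "open \<Omega>" and "connected \<Omega>" and "\<Omega> \<noteq> {}" and "bounded \<Omega>" and "\<Omega> \<subset> UNIV"
    and "complete (closure \<Omega>)" and "bounded (closure \<Omega>)"
    and "doubling_measure (closure \<Omega>) \<mu>"
    and "f \<in> borel_measurable (restrict_space borel (closure \<Omega>))"
    and "\<forall>x \<in> closure \<Omega>. 0 < f x"
    and "infinity_poincare (closure \<Omega>) \<mu>"
    and "in_Linf \<mu> f"
  shows "\<exists>C \<ge> 1.
      (\<forall>x \<in> closure \<Omega>. \<forall>y \<in> closure \<Omega>. x \<noteq> y \<longrightarrow>
         (\<exists>\<gamma>. \<gamma> \<in> quasiconvex_curves (closure \<Omega>) C x y \<inter> Gamma_f (closure \<Omega>) f x y)) \<and>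
      (\<forall>x \<in> closure \<Omega>. \<forall>y \<in> closure \<Omega>. Gamma_f (closure \<Omega>) f x y \<noteq> {}) \<and>
      ((\<lambda>r::real. SUP (x, y) \<in> {(x, y). x \<in> closure \<Omega> \<and> y \<in> closure \<Omega> \<and> dist x y \<le> r}.
          L_f (closure \<Omega>) f x y) \<longlongrightarrow> 0) (at_right 0) \<and>
      (\<forall>x \<in> closure \<Omega>. \<forall>y \<in> closure \<Omega>.
         L_f (closure \<Omega>) f x y \<le> ennreal C * Linf_norm \<mu> f * ennreal (dist x y))"
proof -
  define S where "S = closure \<Omega>"
  obtain D where "doubling S \<mu> D"
    using assms(10) unfolding S_def doubling_measure_def doubling_def by blast
  then interpret doubling S \<mu> D .
  obtain L where L: "1 \<le> L"
    "\<And>w \<rho> K x y. continuous_on S w \<Longrightarrow> upper_gradient S \<rho> w \<Longrightarrow> 0 \<le> K \<Longrightarrow>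
      AE z in \<mu>. \<rho> z \<le> ennreal K \<Longrightarrow> x \<in> S \<Longrightarrow> y \<in> S \<Longrightarrow> \<bar>w x - w y\<bar> \<le> L * K * dist x y"
    using infinity_poincare_imp_lipschitz assms(13) unfolding S_def by blast
  have "compact S"
    unfolding compact_eq_totally_bounded using bounded_imp_totally_bounded assms(8,9) by (simp add: S_def)
  then interpret upper_gradient_lipschitz S \<mu> L
    using L space_eq connected_imp_connected_closure[OF assms(4)] by unfold_locales (auto simp: S_def)
  interpret finite_measure \<mu> using finite_measure_if_bounded assms(9) by (simp add: S_def)
  define M where "M = enn2real (Linf_norm \<mu> f)"
  have M: "Linf_norm \<mu> f = ennreal M" "0 \<le> M"
    using assms(14) by (auto simp: in_Linf_def M_def)
  have AE_f: "AE z in \<mu>. f z \<le> M"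
    using esssup_AE[of "\<lambda>z. ennreal \<bar>f z\<bar>" \<mu>] M unfolding Linf_norm_def by auto
  \<comment> \<open>Transfer to a measure on the whole space, where the approximation by open sets was proved.\<close>
  define \<nu> where "\<nu> = distr \<mu> borel (\<lambda>z. z)"
  have id_meas: "(\<lambda>z. z) \<in> measurable \<mu> borel"
    unfolding measurable_cong_sets[OF sets_eq refl] by (rule measurable_restrict_space1) simp
  have \<nu>: "finite_measure \<nu>" "sets \<nu> = sets borel"
    unfolding \<nu>_def using id_meas by (auto intro: finite_measure_distr)
  define N where "N = {z \<in> S. M < f z}"
  have N_\<mu>: "N \<in> sets \<mu>"
    using assms(11) unfolding N_def S_def[symmetric] borel_measurable_iff[symmetric]
    by (subst space_eq[symmetric]) measurable
  have "closed S" by (simp add: S_def)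
  then have N_borel: "N \<in> sets borel"
    using N_\<mu> unfolding sets_eq by (auto simp: sets_restrict_space)
  have "emeasure \<nu> N = emeasure \<mu> N"
    using N_borel id_meas by (simp add: \<nu>_def emeasure_distr space_eq N_def Int_absorb2 subset_iff)
  also have "\<dots> = 0"
    using AE_f N_\<mu> by (subst (asm) AE_iff_measurable[of N]) (auto simp: N_def space_eq not_le)
  finally have N_null: "N \<in> null_sets \<nu>" using N_borel \<nu>(2) by auto
  obtain U :: "nat \<Rightarrow> 'a set" where U: "\<And>i. open (U i)" "decseq U" "N \<subseteq> (\<Inter>i. U i)"
      and "(\<Inter>i. U i) \<in> null_sets \<nu>"
    using null_set_subset_null_gdelta[OF \<nu> N_null] by metis
  then have "AE z in \<nu>. z \<notin> (\<Inter>i. U i)" by (intro AE_not_in)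
  then have null: "AE z in \<mu>. z \<notin> (\<Inter>i. U i)"
    unfolding \<nu>_def by (rule AE_distrD[OF id_meas])
  define C where "C = L + 2"
  have C: "1 \<le> C" using L by (simp add: C_def)
  have curve: "\<exists>c. c \<in> quasiconvex_curves S C x y \<and> c \<in> Gamma_f S f x y \<and>
      line_integral c (\<lambda>z. ennreal (f z)) \<le> ennreal M * ennreal (C * dist x y)"
    if xy: "x \<in> S" "y \<in> S" "x \<noteq> y" for x y
  proof -
    obtain T \<sigma> where "lip_path S x y T \<sigma>" "T \<le> C * dist x y"
      "AE t in lborel. t \<in> {0..T} \<longrightarrow> \<sigma> t \<notin> (\<Inter>i. U i)"
      using path_avoiding_null_set[OF U(1,2) null xy] unfolding C_def by blast
    moreover have "f z \<le> M" if "z \<in> S" "z \<notin> (\<Inter>i. U i)" for z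
      using that U(3) by (force simp: N_def)
    ultimately show ?thesis
      using arclength_curve_of_lip_path[of S x y T \<sigma> "\<Inter>i. U i" f M C] M(2) by blast
  qed
  have Gamma_ne: "Gamma_f S f x y \<noteq> {}" if "x \<in> S" "y \<in> S" for x y
    using curve[OF that] constant_curve_in_Gamma_f(1)[OF that(1), of f] by (cases "x = y") blast+
  have L_f_bound: "L_f S f x y \<le> ennreal C * Linf_norm \<mu> f * ennreal (dist x y)" if xy: "x \<in> S" "y \<in> S" for x y
  proof (cases "x = y")
    case True
    then show ?thesis
      using L_f_le[OF constant_curve_in_Gamma_f(1)[OF xy(1), of f]]
        constant_curve_in_Gamma_f(2)[OF xy(1)] by simp
  next
    case False
    obtain c where "c \<in> Gamma_f S f x y"
      and le: "line_integral c (\<lambda>z. ennreal (f z)) \<le> ennreal M * ennreal (C * dist x y)"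
      using curve[OF xy False] by blast
    then have "L_f S f x y \<le> ennreal M * ennreal (C * dist x y)"
      using L_f_le[of c] by (meson order_trans)
    also have "\<dots> = ennreal C * Linf_norm \<mu> f * ennreal (dist x y)"
      using C M by (simp add: ennreal_mult mult.commute mult.left_commute)
    finally show ?thesis .
  qed
  have lim: "((\<lambda>r::real. SUP (x, y) \<in> {(x, y). x \<in> S \<and> y \<in> S \<and> dist x y \<le> r}. L_f S f x y) \<longlongrightarrow> 0) (at_right 0)"
  proof (rule tendsto_sandwich[OF _ _ tendsto_const])
    have "((\<lambda>r. ennreal (C * M * r)) \<longlongrightarrow> ennreal (C * M * 0)) (at_right 0)"
      by (intro tendsto_intros)
    then show "((\<lambda>r. ennreal (C * M * r)) \<longlongrightarrow> 0) (at_right 0)" by simp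
    have "(SUP (x, y) \<in> {(x, y). x \<in> S \<and> y \<in> S \<and> dist x y \<le> r}. L_f S f x y) \<le> ennreal (C * M * r)" for r
    proof (rule SUP_least, clarify)
      fix x y assume xy: "x \<in> S" "y \<in> S" "dist x y \<le> r"
      have "ennreal C * Linf_norm \<mu> f * ennreal (dist x y) = ennreal (C * M * dist x y)"
        using C M by (simp add: ennreal_mult)
      also have "\<dots> \<le> ennreal (C * M * r)" using C M xy by (intro ennreal_leI mult_left_mono) auto
      finally show "L_f S f x y \<le> ennreal (C * M * r)" using L_f_bound[OF xy(1,2)] by simp
    qed
    then show "\<forall>\<^sub>F r in at_right 0. (SUP (x, y) \<in> {(x, y). x \<in> S \<and> y \<in> S \<and> dist x y \<le> r}. L_f S f x y)
        \<le> ennreal (C * M * r)" by simp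
  qed simp
  show ?thesis
    unfolding S_def[symmetric]
  proof (intro exI[of _ C] conjI ballI impI C lim L_f_bound Gamma_ne)
    fix x y assume "x \<in> S" "y \<in> S" "x \<noteq> y"
    from curve[OF this] show "\<exists>\<gamma>. \<gamma> \<in> quasiconvex_curves S C x y \<inter> Gamma_f S f x y" by blast
  qed
qed

end
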